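(* Let $1\le m\le r$ and $1\le n\le q$ be integers and put $$\beta((m,n),(r,q))=1-r^{-m}\frac{r!}{(r-m)!}\,q^{-n}\frac{q!}{(q-n)!}.$$ Let $P_{m,n}^{r,q}$ be a row-column exchangeable distribution on real $m\times n$ matrices which is extendible to a row-column exchangeable distribution on real $r\times q$ matrices. Then there exists an infinitely row-column exchangeable distribution on real arrays $(X_{ij})_{i,j\ge1}$ whose projection $P_{\mu,m,n}$ onto the space of $m\times n$ matrices satisfies $$\|P_{m,n}^{r,q}-P_{\mu,m,n}\|\le \beta((m,n),(r,q)),$$ where $\|\cdot\|$ is the total variation norm. The bound is tight: for all integers $1\le m\le r$, $1\le n\le q$ there is a row-column exchangeable distribution $P_{m,n}^{r,q}$ on real $m\times n$ matrices, extendible to a row-column exchangeable distribution on real $r\times q$ matrices, such that $\|P_{m,n}^{r,q}-P_{\mu,m,n}\|\ge\beta((m,n),(r,q))$ for every projection $P_{\mu,m,n}$ onto $m\times n$ matrices of an infinitely row-column exchangeable distribution.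
   Context: A distribution of a random $m\times n$ matrix $X$ is (separately) row-column exchangeable if for all $(g_1,g_2)\in S_m\times S_n$ the matrix $(X_{g_1(i)\,g_2(j)})$ has the same distribution as $X$. It is extendible to $r\times q$ (with $r\ge m$, $q\ge n$) if it is the marginal distribution of the leading $m\times n$ submatrix of a random $r\times q$ matrix whose distribution is row-column exchangeable. A distribution of an infinite array $(X_{ij})_{i,j\ge1}$ is infinitely row-column exchangeable if for all $r,q$ its leading $r\times q$ submatrix has a row-column exchangeable distribution; its projection onto $m\times n$ matrices is the law of the leading $m\times n$ submatrix. The total variation norm is normalized as $\|P-Q\|=\sup_A|P(A)-Q(A)|$, the supremum being over measurable sets $A$. *)

theory Defs
  imports "HOL-Probability.Probability"
begin

text \<open>
  Indices start at 0: a real \<open>m \<times> n\<close> matrix is an element of the extensional function space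
  over \<open>{..<m} \<times> {..<n}\<close>, an infinite array is a function on all of \<open>nat \<times> nat\<close>.
  Both spaces carry the product \<open>\<sigma>\<close>-algebra; for matrices it is the Borel \<open>\<sigma>\<close>-algebra of
  the \<open>m * n\<close>-dimensional real space.
\<close>

definition matrix_space :: "nat \<Rightarrow> nat \<Rightarrow> (nat \<times> nat \<Rightarrow> real) measure" where
  "matrix_space m n = PiM ({..<m} \<times> {..<n}) (\<lambda>_. borel)"

definition array_space :: "(nat \<times> nat \<Rightarrow> real) measure" where
  "array_space = PiM UNIV (\<lambda>_. borel)"

definition submatrix :: "nat \<Rightarrow> nat \<Rightarrow> (nat \<times> nat \<Rightarrow> real) \<Rightarrow> (nat \<times> nat \<Rightarrow> real)" where
  "submatrix m n X = restrict X ({..<m} \<times> {..<n})"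

definition permute_matrix ::
  "nat \<Rightarrow> nat \<Rightarrow> (nat \<Rightarrow> nat) \<Rightarrow> (nat \<Rightarrow> nat) \<Rightarrow> (nat \<times> nat \<Rightarrow> real) \<Rightarrow> (nat \<times> nat \<Rightarrow> real)" where
  "permute_matrix m n g h X = (\<lambda>(i, j) \<in> {..<m} \<times> {..<n}. X (g i, h j))"

definition projection ::
  "nat \<Rightarrow> nat \<Rightarrow> (nat \<times> nat \<Rightarrow> real) measure \<Rightarrow> (nat \<times> nat \<Rightarrow> real) measure" where
  "projection m n P = distr P (matrix_space m n) (submatrix m n)"

definition rc_exchangeable :: "nat \<Rightarrow> nat \<Rightarrow> (nat \<times> nat \<Rightarrow> real) measure \<Rightarrow> bool" where
  "rc_exchangeable m n P \<longleftrightarrow>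
     prob_space P \<and> sets P = sets (matrix_space m n) \<and>
     (\<forall>g h. g permutes {..<m} \<longrightarrow> h permutes {..<n} \<longrightarrow>
        distr P (matrix_space m n) (permute_matrix m n g h) = P)"

definition rc_extendible ::
  "nat \<Rightarrow> nat \<Rightarrow> nat \<Rightarrow> nat \<Rightarrow> (nat \<times> nat \<Rightarrow> real) measure \<Rightarrow> bool" where
  "rc_extendible m n r q P \<longleftrightarrow>
     m \<le> r \<and> n \<le> q \<and> (\<exists>Q. rc_exchangeable r q Q \<and> projection m n Q = P)"

definition inf_rc_exchangeable :: "(nat \<times> nat \<Rightarrow> real) measure \<Rightarrow> bool" where
  "inf_rc_exchangeable Q \<longleftrightarrow>
     prob_space Q \<and> sets Q = sets array_space \<and>
     (\<forall>r\<ge>1. \<forall>q\<ge>1. rc_exchangeable r q (projection r q Q))"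

text \<open>Only meant for probability measures \<open>P\<close> and \<open>Q\<close> with the same measurable sets.\<close>

definition tv_dist :: "'a measure \<Rightarrow> 'a measure \<Rightarrow> real" where
  "tv_dist P Q = (SUP A\<in>sets P. \<bar>measure P A - measure Q A\<bar>)"

definition beta_bound :: "nat \<Rightarrow> nat \<Rightarrow> nat \<Rightarrow> nat \<Rightarrow> real" where
  "beta_bound m n r q =
     1 - inverse (real r ^ m) * (fact r / fact (r - m)) *
         inverse (real q ^ n) * (fact q / fact (q - n))"

text \<open>
  The maps pushed forward above are measurable, so every use of \<^const>\<open>distr\<close> is an
  image measure.
\<close>

lemma submatrix_measurable:
  "m \<le> r \<Longrightarrow> n \<le> q \<Longrightarrow> submatrix m n \<in> measurable (matrix_space r q) (matrix_space m n)"
  unfolding submatrix_def matrix_space_def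
  by (rule measurable_restrict_subset) auto

lemma submatrix_measurable_array:
  "submatrix m n \<in> measurable array_space (matrix_space m n)"
  unfolding submatrix_def matrix_space_def array_space_def
  by (rule measurable_restrict_subset) auto

lemma permute_matrix_measurable:
  assumes "g permutes {..<m}" and "h permutes {..<n}"
  shows "permute_matrix m n g h \<in> measurable (matrix_space m n) (matrix_space m n)"
  unfolding permute_matrix_def matrix_space_def
proof (rule measurable_restrict)
  fix p assume "p \<in> {..<m} \<times> {..<n}"
  then have "(g (fst p), h (snd p)) \<in> {..<m} \<times> {..<n}"
    using permutes_in_image[OF assms(1)] permutes_in_image[OF assms(2)]
    by (auto simp: mem_Times_iff simp del: lessThan_iff)
  then show "(\<lambda>X. case p of (i, j) \<Rightarrow> X (g i, h j))
      \<in> measurable (PiM ({..<m} \<times> {..<n}) (\<lambda>_. borel)) borel"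
    unfolding case_prod_unfold by (rule measurable_component_singleton)
qed

end

theory Submission imports Defs begin

text \<open>
  Upper bound: from a random \<open>r \<times> q\<close> matrix \<open>Z\<close> extending the given one, form the array
  \<open>Z (I i, J j)\<close> with independent uniform row indices \<open>I\<close> and column indices \<open>J\<close>. Its law is
  infinitely exchangeable, and on the event that \<open>I 0, \<dots>, I (m - 1)\<close> and \<open>J 0, \<dots>, J (n - 1)\<close>
  are each pairwise distinct, which has probability \<open>1 - beta_bound m n r q\<close>, its leading
  submatrix has the given law.

  Tightness: let \<open>Z (i, j)\<close> be a code of the pair \<open>(\<pi> i, \<sigma> j)\<close> for independent uniform
  permutations, and let \<open>A\<close> be the support of the leading \<open>m \<times> n\<close> submatrix. For an infinitely
  exchangeable law, the probability of \<open>A\<close> is up to \<open>beta_bound m n N N\<close>, which tends to 0,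
  that of resampling rows and columns of an \<open>N \<times> N\<close> matrix with replacement. For every fixed
  \<open>N \<times> N\<close> matrix the latter is at most \<open>1 - beta_bound m n r q\<close> by Maclaurin's inequality
  for elementary symmetric polynomials: sampling with replacement from \<open>r\<close> colours yields
  pairwise distinct colours most likely when the colours are uniform.
\<close>

subsection \<open>Injective choices and Maclaurin's inequality\<close>

text \<open>Extensionality leaves only finitely many such functions, so that probabilities can be
  computed by counting them.\<close>

definition injections :: "nat \<Rightarrow> nat \<Rightarrow> (nat \<Rightarrow> nat) set" where
  "injections m r = {f \<in> {..<m} \<rightarrow>\<^sub>E {..<r}. inj_on f {..<m}}"

text \<open>For \<open>0 < r\<close>, the probability that \<open>m\<close> independent uniform
  draws from \<open>r\<close> values are pairwise distinct.\<close>

definition inj_fraction :: "nat \<Rightarrow> nat \<Rightarrow> real" where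
  "inj_fraction m r = (\<Prod>k<m. (real r - real k) / real r)"

lemma fact_div_fact_eq_prod:
  assumes "m \<le> r"
  shows "(fact r / fact (r - m) :: real) = (\<Prod>k<m. real r - real k)"
  using assms
proof (induction m)
  case (Suc m)
  have "fact (r - m) = real (r - m) * fact (r - Suc m)"
    using Suc.prems by (metis Suc_diff_Suc Suc_le_lessD fact_Suc of_nat_fact of_nat_mult)
  then have "fact r / fact (r - Suc m) = (fact r / fact (r - m)) * (real r - real m)"
    using Suc.prems by (simp add: of_nat_diff)
  then show ?case using Suc by simp
qed simp

text \<open>Rows and columns are drawn independently, so the two probabilities of drawing without
  repetition multiply; \<open>beta_bound\<close> is the probability of some repetition.\<close>

lemma beta_bound_eq:
  assumes "m \<le> r" "n \<le> q"
  shows "beta_bound m n r q = 1 - inj_fraction m r * inj_fraction n q"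
proof -
  have "inverse (real r ^ m) * (fact r / fact (r - m)) = inj_fraction m r"
    if "m \<le> r" for m r
    unfolding fact_div_fact_eq_prod[OF that] inj_fraction_def by (simp add: prod_dividef field_simps)
  from this[OF assms(1)] this[OF assms(2)] show ?thesis
    unfolding beta_bound_def by (metis mult.assoc)
qed

lemma card_inj_PiE:
  assumes "finite B" and "m \<le> card B"
  shows "real (card {f \<in> {..<m} \<rightarrow>\<^sub>E B. inj_on f {..<m}}) = fact (card B) / fact (card B - m)"
proof -
  have "card {f \<in> {..<m} \<rightarrow>\<^sub>E B. inj_on f {..<m}} = prod ((-) (card B)) {0..<m}"
    using card_inj_on_subset_funcset[of "{..<m}" B "{..<m}"] assms by simp
  also have "real \<dots> = (\<Prod>k<m. real (card B) - real k)"
    using assms by (auto simp: lessThan_atLeast0 of_nat_diff intro!: prod.cong)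
  finally show ?thesis using fact_div_fact_eq_prod[OF assms(2)] by simp
qed

lemma card_injections:
  assumes "m \<le> r" "0 < r"
  shows "real (card (injections m r)) = inj_fraction m r * real r ^ m"
proof -
  have "real (card (injections m r)) = (\<Prod>k<m. real r - real k)"
    unfolding injections_def fact_div_fact_eq_prod[OF assms(1), symmetric]
    using card_inj_PiE[of "{..<r}" m] assms(1) by simp
  also have "\<dots> = inj_fraction m r * real r ^ m"
    unfolding inj_fraction_def using assms(2) by (simp add: prod_dividef)
  finally show ?thesis .
qed

lemma finite_injections [simp]: "finite (injections m r)"
proof (rule finite_subset)
  show "injections m r \<subseteq> {..<m} \<rightarrow>\<^sub>E {..<r}"
    unfolding injections_def by blast
qed (simp add: finite_PiE)

lemma inj_fraction_nonneg: "m \<le> r \<Longrightarrow> 0 \<le> inj_fraction m r"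
  unfolding inj_fraction_def by (rule prod_nonneg) auto

text \<open>A fixed number of draws from ever more values hardly ever repeats a value. In the
  tightness proof this makes the resampling error vanish.\<close>

lemma inj_fraction_tendsto: "inj_fraction m \<longlonglongrightarrow> 1"
proof -
  have "(\<lambda>N. (real N - real k) / real N) \<longlonglongrightarrow> 1" for k
    by real_asymp
  then have "(\<lambda>N. \<Prod>k<m. (real N - real k) / real N) \<longlonglongrightarrow> (\<Prod>k<m. 1)"
    by (intro tendsto_prod)
  then show ?thesis unfolding inj_fraction_def by simp
qed

section \<open>Elementary symmetric polynomials\<close>

definition elem_sym :: "nat \<Rightarrow> 'a set \<Rightarrow> ('a \<Rightarrow> real) \<Rightarrow> real" where
  "elem_sym m V w = (\<Sum>T | T \<subseteq> V \<and> card T = m. \<Prod>v\<in>T. w v)"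

lemma elem_sym_0: "finite V \<Longrightarrow> elem_sym 0 V w = 1"
proof -
  assume "finite V"
  then have "{T. T \<subseteq> V \<and> card T = 0} = {{}}" by (auto dest: finite_subset)
  then show ?thesis by (simp add: elem_sym_def)
qed

lemma elem_sym_Suc_empty: "elem_sym (Suc m) {} w = 0"
  by (simp add: elem_sym_def)

text \<open>A subset of \<open>insert v V\<close> either avoids \<open>v\<close> or arises from a
  subset of \<open>V\<close> with one element fewer by adding \<open>v\<close>.\<close>

lemma elem_sym_insert:
  assumes "finite V" "v \<notin> V"
  shows "elem_sym (Suc m) (insert v V) w = elem_sym (Suc m) V w + w v * elem_sym m V w"
proof -
  let ?A = "{T. T \<subseteq> V \<and> card T = Suc m}" and ?B = "{T. T \<subseteq> V \<and> card T = m}"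
  have fin: "finite ?A" "finite ?B" using assms(1) by auto
  have split: "{T. T \<subseteq> insert v V \<and> card T = Suc m} = ?A \<union> insert v ` ?B"
  proof (intro equalityI subsetI)
    fix T assume T: "T \<in> {T. T \<subseteq> insert v V \<and> card T = Suc m}"
    show "T \<in> ?A \<union> insert v ` ?B"
    proof (cases "v \<in> T")
      case True
      then have "T = insert v (T - {v})" "T - {v} \<subseteq> V" "card (T - {v}) = m"
        using T by auto
      then show ?thesis by blast
    qed (use T in auto)
  next
    fix T assume "T \<in> ?A \<union> insert v ` ?B"
    then show "T \<in> {T. T \<subseteq> insert v V \<and> card T = Suc m}"
    proof
      assume "T \<in> insert v ` ?B"
      then obtain U where U: "T = insert v U" "U \<subseteq> V" "card U = m" by blast
      then have "finite U" "v \<notin> U" using assms by (auto intro: finite_subset)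
      then show ?thesis using U by auto
    qed auto
  qed
  have "inj_on (insert v) ?B"
    using assms(2) by (intro inj_onI) (metis (no_types, lifting) Diff_insert_absorb mem_Collect_eq subsetD)
  then have "(\<Sum>T\<in>insert v ` ?B. prod w T) = (\<Sum>T\<in>?B. prod w (insert v T))"
    by (rule sum.reindex_cong) auto
  also have "\<dots> = (\<Sum>T\<in>?B. w v * prod w T)"
    using assms by (intro sum.cong refl prod.insert) (auto dest: finite_subset)
  finally show ?thesis
    unfolding elem_sym_def split using fin assms(2)
    by (subst sum.union_disjoint) (auto simp: sum_distrib_left)
qed

text \<open>Writing \<open>t\<close> for the mean of the old weights and \<open>u\<close> for the increment of the mean
  caused by one more weight, the induction step is Bernoulli's inequality for \<open>1 + u / t\<close>.\<close>

lemma bernoulli_homogeneous: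
  fixes t u :: real
  assumes "0 \<le> t" "0 \<le> t + u"
  shows "t ^ Suc k + real (Suc k) * u * t ^ k \<le> (t + u) ^ Suc k"
proof (cases "t = 0")
  case True
  then show ?thesis using assms by (cases k) auto
next
  case False
  then have t: "t > 0" using assms by simp
  have "1 + real (Suc k) * (u / t) \<le> (1 + u / t) ^ Suc k"
    using t assms by (intro Bernoulli_inequality) (simp add: field_simps)
  then have "t ^ Suc k * (1 + real (Suc k) * (u / t)) \<le> t ^ Suc k * (1 + u / t) ^ Suc k"
    using t by (intro mult_left_mono) auto
  also have "\<dots> = (t * (1 + u / t)) ^ Suc k" by (simp only: power_mult_distrib)
  also have "t * (1 + u / t) = t + u" using t by (simp add: field_simps)
  finally show ?thesis using t by (simp add: algebra_simps)
qed

text \<open>The right side is the value at equal weights with the same sum. The induction adds one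
  weight at a time and keeps \<open>m\<close> arbitrary, since the recurrence
  \<open>elem_sym_insert\<close> involves two consecutive degrees.\<close>

lemma maclaurin_inequality:
  assumes "finite V" and "\<And>v. v \<in> V \<Longrightarrow> 0 \<le> w v"
  shows "elem_sym m V w \<le> real (card V choose m) * (sum w V / real (card V)) ^ m"
  using assms
proof (induction V arbitrary: m rule: finite_induct)
  case empty
  \<comment> \<open>The mean of no weights is 0 by the convention for division by zero, and its
    power is 1 exactly for \<open>m = 0\<close>.\<close>
  then show ?case by (cases m) (simp_all add: elem_sym_0 elem_sym_Suc_empty)
next
  case (insert v V)
  show ?case
  proof (cases m)
    case 0
    then show ?thesis using insert.hyps by (simp add: elem_sym_0)
  next
    case (Suc k)
    define p t where "p = card V" and "t = sum w V / real p"
    define u where "u = (w v - t) / real (Suc p)"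
    have wv: "0 \<le> w v" and t0: "0 \<le> t"
      using insert.prems by (auto simp: t_def intro!: divide_nonneg_nonneg sum_nonneg)
    \<comment> \<open>For \<open>p = 0\<close> the default value \<open>t = 0\<close> agrees with
      the empty sum.\<close>
    have pt: "real p * t = sum w V"
      using insert.hyps by (cases "p = 0") (auto simp: t_def p_def)
    have mean: "t + u = sum w (insert v V) / real (Suc p)"
      using insert.hyps pt by (simp add: u_def field_simps)
    have nn: "0 \<le> t + u"
      unfolding mean using insert.prems by (intro divide_nonneg_nonneg sum_nonneg) auto
    have IH: "elem_sym j V w \<le> real (p choose j) * t ^ j" for j
      using insert.IH insert.prems unfolding p_def t_def by simp
    \<comment> \<open>These two binomial identities give both terms of the recurrence the common
      factor \<open>Suc p choose Suc k\<close>; what remains is the left side of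
      \<open>bernoulli_homogeneous\<close>.\<close>
    have c1: "real (p choose k) * real (Suc p) = real (Suc k) * real (Suc p choose Suc k)"
      using Suc_times_binomial[of k p] by (metis mult.commute of_nat_mult)
    have c2: "real (p choose Suc k) = real (Suc p choose Suc k) - real (p choose k)"
      by simp
    have "elem_sym m (insert v V) w = elem_sym (Suc k) V w + w v * elem_sym k V w"
      unfolding Suc using insert.hyps by (intro elem_sym_insert)
    also have "\<dots> \<le> real (p choose Suc k) * t ^ Suc k + w v * (real (p choose k) * t ^ k)"
      using IH wv by (intro add_mono mult_left_mono)
    also have "\<dots> = real (Suc p choose Suc k) * t ^ Suc k
        + real (p choose k) * (w v - t) * t ^ k"
      unfolding c2 by (simp add: algebra_simps)
    also have "real (p choose k) * (w v - t) = real (p choose k) * real (Suc p) * u"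
      by (simp add: u_def)
    also have "\<dots> = real (Suc k) * real (Suc p choose Suc k) * u"
      by (simp only: c1)
    also have "real (Suc p choose Suc k) * t ^ Suc k
        + real (Suc k) * real (Suc p choose Suc k) * u * t ^ k
        = real (Suc p choose Suc k) * (t ^ Suc k + real (Suc k) * u * t ^ k)"
      by (simp only: algebra_simps)
    also have "\<dots> \<le> real (Suc p choose Suc k) * (t + u) ^ Suc k"
      using t0 nn by (intro mult_left_mono bernoulli_homogeneous) auto
    finally show ?thesis
      using insert.hyps unfolding mean by (simp add: Suc p_def)
  qed
qed

section \<open>Weighted counts of injective choices\<close>

lemma sum_injections:
  "(\<Sum>f\<in>injections m r. \<Prod>k<m. w (f k)) = fact m * elem_sym m {..<r} w"
proof -
  let ?T = "{T. T \<subseteq> {..<r} \<and> card T = m}"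
  have img: "(\<lambda>f. f ` {..<m}) ` injections m r \<subseteq> ?T"
    unfolding injections_def by (auto simp: card_image PiE_iff)
  have "(\<Sum>f\<in>injections m r. \<Prod>k<m. w (f k))
      = (\<Sum>T\<in>?T. \<Sum>f\<in>{f \<in> injections m r. f ` {..<m} = T}. \<Prod>k<m. w (f k))"
    by (rule sum.group[symmetric, OF _ _ img]) auto
  \<comment> \<open>Each \<open>T\<close> is the image of exactly \<open>fact m\<close> injections,
    and all of them contribute the same product.\<close>
  also have "\<dots> = (\<Sum>T\<in>?T. fact m * prod w T)"
  proof (rule sum.cong[OF refl])
    fix T assume T: "T \<in> ?T"
    then have fT: "finite T" by (auto dest: finite_subset)
    have eq: "{f \<in> injections m r. f ` {..<m} = T} = {f \<in> {..<m} \<rightarrow>\<^sub>E T. inj_on f {..<m}}"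
    proof (intro equalityI subsetI)
      fix f assume f: "f \<in> {f \<in> {..<m} \<rightarrow>\<^sub>E T. inj_on f {..<m}}"
      then have "f ` {..<m} = T"
        using T fT by (intro card_subset_eq) (auto simp: card_image)
      then show "f \<in> {f \<in> injections m r. f ` {..<m} = T}"
        using f T unfolding injections_def by (auto simp: PiE_iff)
    qed (auto simp: injections_def PiE_iff)
    have "(\<Sum>f\<in>{f \<in> injections m r. f ` {..<m} = T}. \<Prod>k<m. w (f k))
        = (\<Sum>f\<in>{f \<in> injections m r. f ` {..<m} = T}. prod w T)"
    proof (rule sum.cong[OF refl])
      fix f assume f: "f \<in> {f \<in> injections m r. f ` {..<m} = T}"
      then have "inj_on f {..<m}" by (simp add: injections_def)
      from prod.reindex[OF this, of w] f show "(\<Prod>k<m. w (f k)) = prod w T" by simp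
    qed
    also have "\<dots> = fact m * prod w T"
      using card_inj_PiE[OF fT, of m] T unfolding eq by simp
    finally show "(\<Sum>f\<in>{f \<in> injections m r. f ` {..<m} = T}. \<Prod>k<m. w (f k)) = fact m * prod w T" .
  qed
  finally show ?thesis by (simp add: elem_sym_def sum_distrib_left)
qed

text \<open>If \<open>w\<close> sums to 1, the left side is the probability that \<open>m\<close>
  independent draws with law \<open>w\<close> are pairwise distinct. By Maclaurin's inequality it is
  largest for uniform weights, where it equals \<open>inj_fraction m r\<close>.\<close>

lemma sum_injections_le:
  assumes "m \<le> r" and "\<And>v. v < r \<Longrightarrow> 0 \<le> w v"
  shows "(\<Sum>f\<in>injections m r. \<Prod>k<m. w (f k)) \<le> inj_fraction m r * sum w {..<r} ^ m"
proof -
  have "fact m * elem_sym m {..<r} w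
      \<le> fact m * (real (r choose m) * (sum w {..<r} / real r) ^ m)"
    using maclaurin_inequality[of "{..<r}" w m] assms by (intro mult_left_mono) auto
  also have "\<dots> = (fact m * real (r choose m) / real r ^ m) * sum w {..<r} ^ m"
    by (simp add: power_divide)
  also have "fact m * real (r choose m) = (\<Prod>k<m. real r - real k)"
    using binomial_fact[OF assms(1), where 'a = real]
    by (simp flip: fact_div_fact_eq_prod[OF assms(1)])
  also have "\<dots> / real r ^ m = inj_fraction m r"
    unfolding inj_fraction_def by (simp add: prod_dividef)
  finally show ?thesis by (subst sum_injections)
qed

text \<open>Grouping the choices by their colour sequence turns the count into a sum over injective
  colour sequences, weighted by the sizes of the colour classes.\<close>

lemma card_rainbow_le:
  fixes c :: "'a \<Rightarrow> nat"
  assumes "m \<le> r" "finite S" "c ` S \<subseteq> {..<r}"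
  shows "real (card {f \<in> {..<m} \<rightarrow>\<^sub>E S. inj_on (c \<circ> f) {..<m}})
    \<le> inj_fraction m r * real (card S) ^ m"
proof -
  define w where "w v = real (card {s \<in> S. c s = v})" for v
  let ?X = "{f \<in> {..<m} \<rightarrow>\<^sub>E S. inj_on (c \<circ> f) {..<m}}"
  let ?\<phi> = "\<lambda>f. restrict (c \<circ> f) {..<m}"
  have finX: "finite ?X"
  proof (rule finite_subset)
    show "?X \<subseteq> {..<m} \<rightarrow>\<^sub>E S" by blast
  qed (simp add: finite_PiE assms(2))
  have img: "?\<phi> ` ?X \<subseteq> injections m r"
    using assms(3) unfolding injections_def by (auto simp: inj_on_def PiE_iff image_subset_iff)
  have "real (card ?X) = (\<Sum>f\<in>?X. 1)" by simp
  also have "\<dots> = (\<Sum>\<phi>\<in>injections m r. \<Sum>f\<in>{f \<in> ?X. ?\<phi> f = \<phi>}. 1)"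
    by (rule sum.group[symmetric, OF finX _ img]) simp
  also have "\<dots> = (\<Sum>\<phi>\<in>injections m r. \<Prod>k<m. w (\<phi> k))"
  proof (rule sum.cong[OF refl])
    fix \<phi> assume phi: "\<phi> \<in> injections m r"
    have "{f \<in> ?X. ?\<phi> f = \<phi>} = (\<Pi>\<^sub>E k\<in>{..<m}. {s \<in> S. c s = \<phi> k})"
    proof (intro equalityI subsetI)
      fix f assume f: "f \<in> (\<Pi>\<^sub>E k\<in>{..<m}. {s \<in> S. c s = \<phi> k})"
      have c: "c (f k) = \<phi> k" if "k < m" for k
        using PiE_mem[OF f] that by simp
      \<comment> \<open>Both functions are undefined outside \<open>{..<m}\<close>, so agreement on
        the first \<open>m\<close> arguments gives equality.\<close>
      have "?\<phi> f = restrict \<phi> {..<m}"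
        using c by (intro restrict_ext) simp
      also have "\<dots> = \<phi>"
        using phi unfolding injections_def by (intro extensional_restrict) (simp add: PiE_def)
      finally have eq: "?\<phi> f = \<phi>" .
      have "inj_on (c \<circ> f) {..<m} \<longleftrightarrow> inj_on \<phi> {..<m}"
        using c by (intro inj_on_cong) simp
      then have "inj_on (c \<circ> f) {..<m}"
        using phi unfolding injections_def by simp
      moreover have "f \<in> {..<m} \<rightarrow>\<^sub>E S"
        using f by (rule subsetD[OF PiE_mono, rotated]) auto
      ultimately show "f \<in> {f \<in> ?X. ?\<phi> f = \<phi>}"
        using eq by blast
    next
      fix f assume f: "f \<in> {f \<in> ?X. ?\<phi> f = \<phi>}"
      then have eq: "?\<phi> f = \<phi>" and fS: "f \<in> {..<m} \<rightarrow>\<^sub>E S" by blast+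
      have "f k \<in> S" "c (f k) = \<phi> k" if "k < m" for k
        using that PiE_mem[OF fS] fun_cong[OF eq, of k] by auto
      then show "f \<in> (\<Pi>\<^sub>E k\<in>{..<m}. {s \<in> S. c s = \<phi> k})"
        using PiE_arb[OF fS] by (intro PiE_I) auto
    qed
    then show "(\<Sum>f\<in>{f \<in> ?X. ?\<phi> f = \<phi>}. 1) = (\<Prod>k<m. w (\<phi> k))"
      by (simp add: card_PiE w_def)
  qed
  also have "\<dots> \<le> inj_fraction m r * sum w {..<r} ^ m"
    using assms(1) by (intro sum_injections_le) (auto simp: w_def)
  also have "sum w {..<r} = real (card S)"
  proof -
    have "(\<Sum>v<r. \<Sum>s\<in>{s \<in> S. c s = v}. 1) = (\<Sum>s\<in>S. 1::real)"
      by (rule sum.group[OF assms(2) _ assms(3)]) simp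
    then show ?thesis by (simp add: w_def)
  qed
  finally show ?thesis .
qed

text \<open>Fix the columns \<open>g\<close> and the column labels \<open>\<gamma>\<close>. The admissible rows form a set \<open>S g \<gamma>\<close> coloured by
  their row labels, so the choices of \<open>f\<close> number at most
  \<open>inj_fraction m r * card (S g \<gamma>) ^ m\<close>. Keeping one of these \<open>m\<close> factors and bounding the
  others by \<open>N\<close> leaves the number of triples of a row \<open>i\<close>, columns \<open>g\<close> and labels \<open>\<gamma>\<close>; as
  row \<open>i\<close> determines \<open>\<gamma>\<close>, this counts rainbow choices of \<open>g\<close> within single rows.\<close>

lemma card_labelled_grid_le:
  fixes R C :: "nat \<Rightarrow> nat \<Rightarrow> nat" and N :: nat
  assumes "1 \<le> m" "m \<le> r" "1 \<le> n" "n \<le> q"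
  defines "G \<equiv> {(f, g). f \<in> {..<m} \<rightarrow>\<^sub>E {..<N} \<and> g \<in> {..<n} \<rightarrow>\<^sub>E {..<N} \<and>
      (\<exists>\<rho>\<in>injections m r. \<exists>\<gamma>\<in>injections n q.
         \<forall>i<m. \<forall>j<n. R (f i) (g j) = \<rho> i \<and> C (f i) (g j) = \<gamma> j)}"
  shows "real (card G) \<le> inj_fraction m r * inj_fraction n q * (real N ^ m * real N ^ n)"
proof -
  \<comment> \<open>Row labels are read in the single column \<open>g 0\<close>, which is among the
    chosen ones because \<open>1 \<le> n\<close>. This weakens the condition defining
    \<open>G\<close>, so the count can only grow.\<close>
  define S where "S g \<gamma> = {i \<in> {..<N}. R i (g 0) < r \<and> (\<forall>j<n. C i (g j) = \<gamma> j)}" for g \<gamma>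
  define F where "F g \<gamma> = {f \<in> {..<m} \<rightarrow>\<^sub>E S g \<gamma>. inj_on ((\<lambda>i. R i (g 0)) \<circ> f) {..<m}}" for g \<gamma>
  define H where "H i = {g \<in> {..<n} \<rightarrow>\<^sub>E {k \<in> {..<N}. C i k < q}. inj_on (C i \<circ> g) {..<n}}" for i
  let ?E = "{..<n} \<rightarrow>\<^sub>E {..<N}" and ?I = "injections n q"
  have finE: "finite ?E" by (simp add: finite_PiE)
  have finS: "finite (S g \<gamma>)" for g \<gamma> unfolding S_def by simp
  have finF: "finite (F g \<gamma>)" for g \<gamma>
  proof (rule finite_subset)
    show "F g \<gamma> \<subseteq> {..<m} \<rightarrow>\<^sub>E S g \<gamma>" unfolding F_def by blast
  qed (simp add: finite_PiE finS)
  have finH: "finite (H i)" for i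
  proof (rule finite_subset)
    show "H i \<subseteq> {..<n} \<rightarrow>\<^sub>E {k \<in> {..<N}. C i k < q}" unfolding H_def by blast
  qed (simp add: finite_PiE)

  have "G \<subseteq> (\<lambda>(g, \<gamma>, f). (f, g)) ` (SIGMA g:?E. SIGMA \<gamma>:?I. F g \<gamma>)"
  proof
    fix p assume "p \<in> G"
    then obtain f g \<rho> \<gamma> where p: "p = (f, g)" and f: "f \<in> {..<m} \<rightarrow>\<^sub>E {..<N}"
      and g: "g \<in> {..<n} \<rightarrow>\<^sub>E {..<N}" and rho: "\<rho> \<in> injections m r" and gamma: "\<gamma> \<in> ?I"
      and RC: "\<And>i j. i < m \<Longrightarrow> j < n \<Longrightarrow> R (f i) (g j) = \<rho> i \<and> C (f i) (g j) = \<gamma> j"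
      unfolding G_def by blast
    have "\<rho> i < r" if "i < m" for i
      using rho that unfolding injections_def by auto
    then have "f i \<in> S g \<gamma>" if "i < m" for i
      using RC[OF that] PiE_mem[OF f, of i] that assms(3) unfolding S_def by simp
    then have "f \<in> {..<m} \<rightarrow>\<^sub>E S g \<gamma>"
      using PiE_arb[OF f] by (intro PiE_I) auto
    moreover have "inj_on ((\<lambda>i. R i (g 0)) \<circ> f) {..<m} \<longleftrightarrow> inj_on \<rho> {..<m}"
      using RC assms(3) by (intro inj_on_cong) simp
    ultimately have "f \<in> F g \<gamma>"
      using rho unfolding F_def injections_def by simp
    then show "p \<in> (\<lambda>(g, \<gamma>, f). (f, g)) ` (SIGMA g:?E. SIGMA \<gamma>:?I. F g \<gamma>)"
      using p g gamma by (auto intro!: image_eqI[of _ _ "(g, \<gamma>, f)"])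
  qed
  then have "card G \<le> card (SIGMA g:?E. SIGMA \<gamma>:?I. F g \<gamma>)"
    using finE finF by (intro surj_card_le finite_SigmaI) auto
  also have "\<dots> = (\<Sum>g\<in>?E. \<Sum>\<gamma>\<in>?I. card (F g \<gamma>))"
    using finE finF by (simp add: card_SigmaI)
  finally have "real (card G) \<le> real (\<Sum>g\<in>?E. \<Sum>\<gamma>\<in>?I. card (F g \<gamma>))"
    by (rule of_nat_mono)
  also have "\<dots> = (\<Sum>g\<in>?E. \<Sum>\<gamma>\<in>?I. real (card (F g \<gamma>)))"
    by simp
  also have "\<dots> \<le> (\<Sum>g\<in>?E. \<Sum>\<gamma>\<in>?I. inj_fraction m r * (real N ^ (m - 1) * real (card (S g \<gamma>))))"
  proof (intro sum_mono)
    fix g \<gamma>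
    have "card (S g \<gamma>) \<le> card {..<N}"
      unfolding S_def by (intro card_mono) auto
    then have "real (card (S g \<gamma>)) ^ (m - 1) * real (card (S g \<gamma>))
        \<le> real N ^ (m - 1) * real (card (S g \<gamma>))"
      by (intro mult_right_mono power_mono) auto
    moreover have "real (card (S g \<gamma>)) ^ (m - 1) * real (card (S g \<gamma>)) = real (card (S g \<gamma>)) ^ m"
      using assms(1) by (metis One_nat_def Suc_le_D diff_Suc_1 power_Suc2)
    moreover have "real (card (F g \<gamma>)) \<le> inj_fraction m r * real (card (S g \<gamma>)) ^ m"
      unfolding F_def using assms(2) finS by (intro card_rainbow_le) (auto simp: S_def)
    ultimately show "real (card (F g \<gamma>))
        \<le> inj_fraction m r * (real N ^ (m - 1) * real (card (S g \<gamma>)))"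
      using inj_fraction_nonneg[OF assms(2)] by (metis mult_left_mono order_trans)
  qed
  also have "\<dots> = inj_fraction m r * real N ^ (m - 1) * real (\<Sum>g\<in>?E. \<Sum>\<gamma>\<in>?I. card (S g \<gamma>))"
    by (simp add: sum_distrib_left mult.assoc)
  also have "(\<Sum>g\<in>?E. \<Sum>\<gamma>\<in>?I. card (S g \<gamma>)) = card (SIGMA g:?E. SIGMA \<gamma>:?I. S g \<gamma>)"
    using finE finS by (simp add: card_SigmaI)
  also have "real \<dots> \<le> real N * (inj_fraction n q * real N ^ n)"
  proof -
    have "card (SIGMA g:?E. SIGMA \<gamma>:?I. S g \<gamma>) \<le> card (SIGMA i:{..<N}. H i)"
    proof (rule card_inj_on_le[where f = "\<lambda>(g, \<gamma>, i). (i, g)"])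
      have unique: "\<gamma> = \<gamma>'" if "\<gamma> \<in> ?I" "\<gamma>' \<in> ?I" "i \<in> S g \<gamma>" "i \<in> S g \<gamma>'" for \<gamma> \<gamma>' i g
      proof (rule PiE_ext)
        show "\<gamma> \<in> {..<n} \<rightarrow>\<^sub>E {..<q}" "\<gamma>' \<in> {..<n} \<rightarrow>\<^sub>E {..<q}"
          using that unfolding injections_def by blast+
        show "\<gamma> j = \<gamma>' j" if "j \<in> {..<n}" for j
          using \<open>i \<in> S g \<gamma>\<close> \<open>i \<in> S g \<gamma>'\<close> that unfolding S_def by auto
      qed
      show "inj_on (\<lambda>(g, \<gamma>, i). (i, g)) (SIGMA g:?E. SIGMA \<gamma>:?I. S g \<gamma>)"
        by (rule inj_onI) (auto dest: unique)
      have "g \<in> H i" if g: "g \<in> ?E" and gamma: "\<gamma> \<in> ?I" and i: "i \<in> S g \<gamma>" for g \<gamma> i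
      proof -
        have C: "C i (g j) = \<gamma> j" if "j < n" for j
          using i that unfolding S_def by simp
        moreover have "\<gamma> j < q" if "j < n" for j
          using gamma that unfolding injections_def by auto
        ultimately have "g j \<in> {k \<in> {..<N}. C i k < q}" if "j < n" for j
          using PiE_mem[OF g] that by simp
        then have "g \<in> {..<n} \<rightarrow>\<^sub>E {k \<in> {..<N}. C i k < q}"
          using PiE_arb[OF g] by (intro PiE_I) auto
        moreover have "inj_on (C i \<circ> g) {..<n} \<longleftrightarrow> inj_on \<gamma> {..<n}"
          using C by (intro inj_on_cong) simp
        ultimately show ?thesis
          using gamma unfolding H_def injections_def by simp
      qed
      then show "(\<lambda>(g, \<gamma>, i). (i, g)) ` (SIGMA g:?E. SIGMA \<gamma>:?I. S g \<gamma>) \<subseteq> (SIGMA i:{..<N}. H i)"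
        by (auto simp: S_def)
      show "finite (SIGMA i:{..<N}. H i)" using finH by auto
    qed
    also have "\<dots> = (\<Sum>i<N. card (H i))" using finH by (simp add: card_SigmaI)
    finally have "real (card (SIGMA g:?E. SIGMA \<gamma>:?I. S g \<gamma>)) \<le> real (\<Sum>i<N. card (H i))"
      by (rule of_nat_mono)
    also have "\<dots> = (\<Sum>i<N. real (card (H i)))"
      by simp
    also have "\<dots> \<le> (\<Sum>i<N. inj_fraction n q * real N ^ n)"
    proof (rule sum_mono)
      fix i
      let ?K = "{k \<in> {..<N}. C i k < q}"
      have "card ?K \<le> card {..<N}" by (intro card_mono) auto
      then have "inj_fraction n q * real (card ?K) ^ n \<le> inj_fraction n q * real N ^ n"
        using inj_fraction_nonneg[OF assms(4)] by (intro mult_left_mono power_mono) auto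
      moreover have "real (card (H i)) \<le> inj_fraction n q * real (card ?K) ^ n"
        unfolding H_def using assms(4) by (intro card_rainbow_le) auto
      ultimately show "real (card (H i)) \<le> inj_fraction n q * real N ^ n" by linarith
    qed
    finally show ?thesis by simp
  qed
  also have "inj_fraction m r * real N ^ (m - 1) * (real N * (inj_fraction n q * real N ^ n))
      = inj_fraction m r * inj_fraction n q * (real N ^ (m - 1) * real N * real N ^ n)"
    by (simp only: ac_simps)
  also have "real N ^ (m - 1) * real N = real N ^ m"
    using assms(1) by (metis One_nat_def Suc_le_D diff_Suc_1 power_Suc2)
  finally show ?thesis
    using inj_fraction_nonneg[OF assms(2)] by (simp add: mult_left_mono)
qed

subsection \<open>Resampling rows and columns with replacement\<close>

definition index_maps :: "nat \<Rightarrow> nat \<Rightarrow> nat \<Rightarrow> nat \<Rightarrow> ((nat \<Rightarrow> nat) \<times> (nat \<Rightarrow> nat)) set" where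
  "index_maps m n r q = ({..<m} \<rightarrow>\<^sub>E {..<r}) \<times> ({..<n} \<rightarrow>\<^sub>E {..<q})"

text \<open>The probability of \<open>A\<close> for the \<open>m \<times> n\<close> matrix whose row and column indices are drawn from those of a
  \<open>Q\<close>-distributed \<open>r \<times> q\<close> matrix independently and with replacement.\<close>

definition resampled_prob ::
  "nat \<Rightarrow> nat \<Rightarrow> nat \<Rightarrow> nat \<Rightarrow> (nat \<times> nat \<Rightarrow> real) measure \<Rightarrow> (nat \<times> nat \<Rightarrow> real) set \<Rightarrow> real" where
  "resampled_prob m n r q Q A =
     (\<Sum>(f, g)\<in>index_maps m n r q. measure (distr Q (matrix_space m n) (permute_matrix m n f g)) A)
     / (real r ^ m * real q ^ n)"

lemma finite_index_maps [simp]: "finite (index_maps m n r q)"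
  by (simp add: index_maps_def finite_PiE)

lemma card_index_maps: "real (card (index_maps m n r q)) = real r ^ m * real q ^ n"
  by (simp add: index_maps_def card_PiE card_cartesian_product)

section \<open>Submatrices selected by index maps\<close>

lemma submatrix_eq_permute_matrix: "submatrix m n = permute_matrix m n id id"
  by (auto simp: submatrix_def permute_matrix_def fun_eq_iff restrict_def)

lemma permute_matrix_cong:
  assumes "\<And>i. i < m \<Longrightarrow> f i = f' i" "\<And>j. j < n \<Longrightarrow> g j = g' j"
  shows "permute_matrix m n f g = permute_matrix m n f' g'"
  using assms by (auto simp: permute_matrix_def fun_eq_iff restrict_def)

text \<open>Selection pulls indices back, so the outer maps act on an index first. Their range
  conditions keep the inner matrix from being read where it is undefined.\<close>

lemma permute_matrix_comp:
  assumes "f \<in> {..<m} \<rightarrow> {..<r}" "g \<in> {..<n} \<rightarrow> {..<q}"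
  shows "permute_matrix m n f g (permute_matrix r q f' g' X) = permute_matrix m n (f' \<circ> f) (g' \<circ> g) X"
  using assms by (auto simp: permute_matrix_def fun_eq_iff restrict_def Pi_iff)

lemma permute_matrix_measurable':
  assumes "f \<in> {..<m} \<rightarrow> {..<r}" "g \<in> {..<n} \<rightarrow> {..<q}"
  shows "permute_matrix m n f g \<in> measurable (matrix_space r q) (matrix_space m n)"
  unfolding permute_matrix_def matrix_space_def
proof (rule measurable_restrict)
  fix p assume "p \<in> {..<m} \<times> {..<n}"
  then have "(f (fst p), g (snd p)) \<in> {..<r} \<times> {..<q}"
    using assms by (auto simp: Pi_iff)
  then show "(\<lambda>X. case p of (i, j) \<Rightarrow> X (f i, g j))
      \<in> measurable (PiM ({..<r} \<times> {..<q}) (\<lambda>_. borel)) borel"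
    unfolding case_prod_unfold by (rule measurable_component_singleton)
qed

lemma rc_exchangeableD:
  assumes "rc_exchangeable r q Q"
  shows "prob_space Q" "sets Q = sets (matrix_space r q)"
    and "g permutes {..<r} \<Longrightarrow> h permutes {..<q} \<Longrightarrow>
      distr Q (matrix_space r q) (permute_matrix r q g h) = Q"
  using assms unfolding rc_exchangeable_def by blast+

text \<open>The indices from \<open>m\<close> on and the values not taken by \<open>f\<close> are
  equally many, so any bijection between them completes \<open>f\<close>.\<close>

lemma injection_extends_to_permutation:
  assumes "m \<le> r" "f \<in> injections m r"
  obtains p where "p permutes {..<r}" "\<And>i. i < m \<Longrightarrow> p i = f i"
proof -
  have f: "inj_on f {..<m}" "f ` {..<m} \<subseteq> {..<r}"
    using assms(2) unfolding injections_def by auto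
  have "card ({..<r} - {..<m}) = card ({..<r} - f ` {..<m})"
    using assms(1) f by (simp add: card_Diff_subset card_image)
  then obtain h where h: "bij_betw h ({..<r} - {..<m}) ({..<r} - f ` {..<m})"
    using finite_same_card_bij[of "{..<r} - {..<m}" "{..<r} - f ` {..<m}"] by auto
  define p where "p i = (if i < m then f i else if i < r then h i else i)" for i
  have "bij_betw p {..<m} (f ` {..<m})"
    using f(1) unfolding bij_betw_def p_def inj_on_def by auto
  moreover have "bij_betw p ({..<r} - {..<m}) ({..<r} - f ` {..<m})"
    using h by (rule bij_betw_cong[THEN iffD1, rotated]) (auto simp: p_def)
  ultimately have "bij_betw p ({..<m} \<union> ({..<r} - {..<m})) (f ` {..<m} \<union> ({..<r} - f ` {..<m}))"
    by (rule bij_betw_combine) auto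
  moreover have "{..<m} \<union> ({..<r} - {..<m}) = {..<r}" using assms(1) by auto
  moreover have "f ` {..<m} \<union> ({..<r} - f ` {..<m}) = {..<r}" using f(2) by auto
  ultimately have "bij_betw p {..<r} {..<r}" by simp
  then have "p permutes {..<r}"
    using assms(1) by (intro bij_imp_permutes) (auto simp: p_def)
  then show ?thesis using that by (simp add: p_def)
qed

text \<open>A selection without repetition is the leading corner of a matrix with permuted rows and
  columns, so exchangeability gives it the law of the leading corner.\<close>

lemma distr_permute_matrix_injections:
  assumes Q: "rc_exchangeable r q Q" and "m \<le> r" "n \<le> q"
    and f: "f \<in> injections m r" and g: "g \<in> injections n q"
  shows "distr Q (matrix_space m n) (permute_matrix m n f g) = projection m n Q"
proof -
  obtain p where p: "p permutes {..<r}" "\<And>i. i < m \<Longrightarrow> p i = f i"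
    using injection_extends_to_permutation[OF assms(2) f] by blast
  obtain s where s: "s permutes {..<q}" "\<And>j. j < n \<Longrightarrow> s j = g j"
    using injection_extends_to_permutation[OF assms(3) g] by blast
  have comp: "submatrix m n \<circ> permute_matrix r q p s = permute_matrix m n f g"
  proof
    fix X
    have "submatrix m n (permute_matrix r q p s X) = permute_matrix m n p s X"
      unfolding submatrix_eq_permute_matrix using assms(2,3) by (subst permute_matrix_comp) auto
    also have "\<dots> = permute_matrix m n f g X"
      using p(2) s(2) by (subst permute_matrix_cong) auto
    finally show "(submatrix m n \<circ> permute_matrix r q p s) X = permute_matrix m n f g X" by simp
  qed
  have "permute_matrix r q p s \<in> measurable Q (matrix_space r q)"
    using permute_matrix_measurable[OF p(1) s(1)] measurable_cong_sets[OF rc_exchangeableD(2)[OF Q] refl]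
    by blast
  then have "distr (distr Q (matrix_space r q) (permute_matrix r q p s)) (matrix_space m n) (submatrix m n)
      = distr Q (matrix_space m n) (permute_matrix m n f g)"
    using submatrix_measurable[OF assms(2,3)] by (subst distr_distr) (auto simp: comp)
  then show ?thesis
    unfolding projection_def rc_exchangeableD(3)[OF Q p(1) s(1)] by simp
qed

lemma permute_matrix_measurable_index_maps:
  assumes "sets Q = sets (matrix_space r q)" and "(f, g) \<in> index_maps m n r q"
  shows "permute_matrix m n f g \<in> measurable Q (matrix_space m n)"
  using permute_matrix_measurable'[of f m r g n q] assms(2)
  unfolding measurable_cong_sets[OF assms(1) refl] index_maps_def by (auto simp: PiE_def)

lemma prob_space_projection:
  assumes Q: "rc_exchangeable r q Q" and "m \<le> r" "n \<le> q"
  shows "prob_space (projection m n Q)"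
  unfolding projection_def
  using submatrix_measurable[OF assms(2,3)] rc_exchangeableD(1)[OF Q]
    measurable_cong_sets[OF rc_exchangeableD(2)[OF Q] refl]
  by (intro prob_space.prob_space_distr) blast+

text \<open>Injective index maps carry weight \<open>1 - beta_bound m n r q\<close>, and each of
  them yields the projected law; the other maps contribute at least 0 and at most their weight. This
  serves the upper bound and, for \<open>r = q = N\<close>, also tightness.\<close>

lemma resampled_prob_close:
  assumes Q: "rc_exchangeable r q Q" and "m \<le> r" "n \<le> q" "0 < r" "0 < q"
  shows "\<bar>measure (projection m n Q) A - resampled_prob m n r q Q A\<bar> \<le> beta_bound m n r q"
proof -
  let ?D = "\<lambda>p. measure (distr Q (matrix_space m n) (permute_matrix m n (fst p) (snd p))) A"
  let ?E = "index_maps m n r q" and ?I = "injections m r \<times> injections n q"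
  define a where "a = measure (projection m n Q) A"
  define b where "b = inj_fraction m r * inj_fraction n q"
  define M where "M = real r ^ m * real q ^ n"
  have M: "M > 0" using assms by (simp add: M_def)
  have sub: "?I \<subseteq> ?E" unfolding injections_def index_maps_def by blast
  have a01: "0 \<le> a" "a \<le> 1"
    unfolding a_def using prob_space_projection[OF Q assms(2,3)] by (simp_all add: prob_space.prob_le_1)
  have cardI: "real (card ?I) = b * M"
    using assms by (simp add: card_cartesian_product card_injections b_def M_def)
  have "(\<Sum>p\<in>?E. ?D p) = (\<Sum>p\<in>?I. ?D p) + (\<Sum>p\<in>?E - ?I. ?D p)"
    using sub by (simp add: sum.subset_diff)
  also have "(\<Sum>p\<in>?I. ?D p) = (\<Sum>p\<in>?I. a)"
    unfolding a_def using assms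
    by (intro sum.cong refl) (auto simp: distr_permute_matrix_injections)
  also have "\<dots> = b * M * a" using cardI by simp
  finally have S: "(\<Sum>p\<in>?E. ?D p) = b * M * a + (\<Sum>p\<in>?E - ?I. ?D p)" .
  have lo: "0 \<le> (\<Sum>p\<in>?E - ?I. ?D p)" by (intro sum_nonneg) simp
  have "(\<Sum>p\<in>?E - ?I. ?D p) \<le> (\<Sum>p\<in>?E - ?I. 1)"
  proof (rule sum_mono)
    fix p assume "p \<in> ?E - ?I"
    then have "permute_matrix m n (fst p) (snd p) \<in> measurable Q (matrix_space m n)"
      using permute_matrix_measurable_index_maps[OF rc_exchangeableD(2)[OF Q], of "fst p" "snd p" m n]
      by simp
    then show "?D p \<le> 1"
      using rc_exchangeableD(1)[OF Q] by (simp add: prob_space.prob_space_distr prob_space.prob_le_1)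
  qed
  also have "\<dots> = real (card ?E) - real (card ?I)"
  proof -
    have "card ?I \<le> card ?E" using sub by (intro card_mono) auto
    moreover have "card (?E - ?I) = card ?E - card ?I"
      using sub by (intro card_Diff_subset) auto
    ultimately show ?thesis by (simp only: of_nat_diff sum_constant) simp
  qed
  also have "\<dots> = (1 - b) * M"
    using card_index_maps[of m n r q] cardI by (simp add: M_def algebra_simps)
  finally have hi: "(\<Sum>p\<in>?E - ?I. ?D p) \<le> (1 - b) * M" .
  define c where "c = (\<Sum>p\<in>?E - ?I. ?D p) / M"
  have "resampled_prob m n r q Q A = (\<Sum>p\<in>?E. ?D p) / M"
    unfolding resampled_prob_def M_def by (simp add: case_prod_unfold)
  also have "\<dots> = b * a + c" unfolding S c_def using M by (simp add: field_simps)
  finally have avg: "resampled_prob m n r q Q A = b * a + c" .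
  have c: "0 \<le> c" "c \<le> 1 - b" using lo hi M by (simp_all add: c_def field_simps)
  \<comment> \<open>The error is \<open>(1 - b) * a - c\<close>, a difference of two numbers between
    0 and \<open>1 - b\<close>.\<close>
  have "0 \<le> (1 - b) * a" "(1 - b) * a \<le> (1 - b) * 1"
    using a01 c by (intro mult_nonneg_nonneg mult_left_mono; simp)+
  then have "\<bar>a - (b * a + c)\<bar> \<le> 1 - b"
    using c by (simp add: algebra_simps abs_le_iff)
  then show ?thesis
    using assms(2,3) unfolding avg a_def[symmetric] by (simp add: beta_bound_eq b_def)
qed

section \<open>Independent uniform index sequences\<close>

definition cylinder :: "nat \<Rightarrow> nat \<Rightarrow> (nat \<Rightarrow> nat) \<Rightarrow> (nat \<Rightarrow> nat) set" where
  "cylinder r m f = prod_emb UNIV (\<lambda>_. uniform_count_measure {..<r}) {..<m} (\<Pi>\<^sub>E k\<in>{..<m}. {f k})"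

definition iid_indices :: "nat \<Rightarrow> (nat \<Rightarrow> nat) measure" where
  "iid_indices r = PiM UNIV (\<lambda>_. uniform_count_measure {..<r})"

lemma prob_space_iid_indices: "0 < r \<Longrightarrow> prob_space (iid_indices r)"
  unfolding iid_indices_def by (intro prob_space_PiM prob_space_uniform_count_measure) auto

lemma space_iid_indices: "space (iid_indices r) = {I. \<forall>k. I k < r}"
  by (auto simp: iid_indices_def space_PiM space_uniform_count_measure PiE_iff)

lemma mem_cylinder_iff: "I \<in> cylinder r m f \<longleftrightarrow> I \<in> space (iid_indices r) \<and> (\<forall>k<m. I k = f k)"
  by (auto simp: cylinder_def prod_emb_def iid_indices_def space_PiM PiE_iff restrict_def extensional_def)

lemma sets_cylinder:
  assumes "f \<in> {..<m} \<rightarrow> {..<r}"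
  shows "cylinder r m f \<in> sets (iid_indices r)"
  unfolding cylinder_def iid_indices_def using assms
  by (intro sets_PiM_I) (auto simp: sets_uniform_count_measure)

lemma emeasure_cylinder:
  assumes "f \<in> {..<m} \<rightarrow> {..<r}" "0 < r"
  shows "emeasure (iid_indices r) (cylinder r m f) = ennreal (1 / real r ^ m)"
proof -
  have "emeasure (iid_indices r) (cylinder r m f)
      = (\<Prod>k<m. emeasure (uniform_count_measure {..<r}) {f k})"
    unfolding cylinder_def iid_indices_def using assms
    by (intro emeasure_PiM_emb prob_space_uniform_count_measure) (auto simp: sets_uniform_count_measure)
  also have "\<dots> = (\<Prod>k<m. ennreal (1 / real r))"
    using assms by (intro prod.cong refl) (auto simp: emeasure_uniform_count_measure Pi_iff)
  also have "\<dots> = ennreal (1 / real r ^ m)"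
    by (simp add: ennreal_power power_one_over)
  finally show ?thesis .
qed

lemma measurable_iid_indices_component:
  "(\<lambda>I. I k) \<in> measurable (iid_indices r) (count_space {..<r})"
proof -
  have "(\<lambda>I. I k) \<in> measurable (iid_indices r) (uniform_count_measure {..<r})"
    unfolding iid_indices_def by (rule measurable_component_singleton) simp
  then show ?thesis
    by (subst (asm) measurable_cong_sets[OF refl, of _ "count_space {..<r}"])
      (simp_all add: sets_uniform_count_measure)
qed

section \<open>The resampled infinite array\<close>

definition resampling_space ::
  "nat \<Rightarrow> nat \<Rightarrow> (nat \<times> nat \<Rightarrow> real) measure
     \<Rightarrow> ((nat \<times> nat \<Rightarrow> real) \<times> (nat \<Rightarrow> nat) \<times> (nat \<Rightarrow> nat)) measure" where
  "resampling_space r q Q = Q \<Otimes>\<^sub>M (iid_indices r \<Otimes>\<^sub>M iid_indices q)"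

definition resampled_entries ::
  "(nat \<times> nat \<Rightarrow> real) \<times> (nat \<Rightarrow> nat) \<times> (nat \<Rightarrow> nat) \<Rightarrow> nat \<times> nat \<Rightarrow> real" where
  "resampled_entries = (\<lambda>(Z, I, J) (i, j). Z (I i, J j))"

definition resampled_array ::
  "nat \<Rightarrow> nat \<Rightarrow> (nat \<times> nat \<Rightarrow> real) measure \<Rightarrow> (nat \<times> nat \<Rightarrow> real) measure" where
  "resampled_array r q Q = distr (resampling_space r q Q) array_space resampled_entries"

lemma prob_space_resampling_space:
  assumes "prob_space Q" "0 < r" "0 < q"
  shows "prob_space (resampling_space r q Q)"
proof -
  interpret Q: prob_space Q by fact
  interpret I: prob_space "iid_indices r" using assms(2) by (rule prob_space_iid_indices)
  interpret J: prob_space "iid_indices q" using assms(3) by (rule prob_space_iid_indices)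
  interpret IJ: pair_prob_space "iid_indices r" "iid_indices q" ..
  interpret QIJ: pair_prob_space Q "iid_indices r \<Otimes>\<^sub>M iid_indices q" ..
  show ?thesis unfolding resampling_space_def by (rule QIJ.prob_space_axioms)
qed

text \<open>An entry at a random position is measurable because each random index has only finitely
  many values: fixing first the row index and then the column index leaves a coordinate of the
  matrix.\<close>

lemma resampled_entries_measurable:
  assumes "sets Q = sets (matrix_space r q)"
  shows "resampled_entries \<in> measurable (resampling_space r q Q) array_space"
proof -
  let ?\<Omega> = "resampling_space r q Q"
  have I: "(\<lambda>\<omega>. fst (snd \<omega>) i) \<in> measurable ?\<Omega> (count_space {..<r})" for i
    unfolding resampling_space_def
    by (rule measurable_compose[OF _ measurable_iid_indices_component]) simp
  have J: "(\<lambda>\<omega>. snd (snd \<omega>) j) \<in> measurable ?\<Omega> (count_space {..<q})" for j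
    unfolding resampling_space_def
    by (rule measurable_compose[OF _ measurable_iid_indices_component]) simp
  have Z: "(\<lambda>\<omega>. fst \<omega> (a, b)) \<in> borel_measurable ?\<Omega>" if "a < r" "b < q" for a b
  proof -
    have "(\<lambda>Z. Z (a, b)) \<in> borel_measurable Q"
      unfolding measurable_cong_sets[OF assms refl] matrix_space_def
      using that by (intro measurable_component_singleton) auto
    then show ?thesis
      unfolding resampling_space_def by (rule measurable_compose[rotated]) simp
  qed
  have "(\<lambda>\<omega>. fst \<omega> (fst (snd \<omega>) i, snd (snd \<omega>) j)) \<in> borel_measurable ?\<Omega>" for i j
  proof (rule measurable_compose_countable'[where
        f = "\<lambda>a \<omega>. fst \<omega> (a, snd (snd \<omega>) j)", OF _ I])
    fix a assume a: "a \<in> {..<r}"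
    show "(\<lambda>\<omega>. fst \<omega> (a, snd (snd \<omega>) j)) \<in> borel_measurable ?\<Omega>"
    proof (rule measurable_compose_countable'[where f = "\<lambda>b \<omega>. fst \<omega> (a, b)", OF _ J])
      show "(\<lambda>\<omega>. fst \<omega> (a, b)) \<in> borel_measurable ?\<Omega>" if "b \<in> {..<q}" for b
        using a that by (intro Z) simp_all
    qed simp
  qed simp
  then have "(\<lambda>\<omega> p. case p of (i, j) \<Rightarrow> fst \<omega> (fst (snd \<omega>) i, snd (snd \<omega>) j))
      \<in> measurable ?\<Omega> array_space"
    unfolding array_space_def by (intro measurable_PiM_single') (auto simp: case_prod_unfold)
  then show ?thesis
    unfolding resampled_entries_def by (simp add: case_prod_unfold)
qed

text \<open>The leading submatrix depends only on the first \<open>m\<close> row indices and the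
  first \<open>n\<close> column indices. Their possible values split the event into disjoint
  products of an event for the matrix and two cylinders of probabilities \<open>1 / r ^ m\<close>
  and \<open>1 / q ^ n\<close>.\<close>

lemma measure_projection_resampled_array:
  assumes "prob_space Q" and Q: "sets Q = sets (matrix_space r q)" and "0 < r" "0 < q"
    and A: "A \<in> sets (matrix_space m n)"
  shows "measure (projection m n (resampled_array r q Q)) A = resampled_prob m n r q Q A"
proof -
  let ?\<Omega> = "resampling_space r q Q" and ?E = "index_maps m n r q"
  interpret Om: prob_space ?\<Omega> using assms by (intro prob_space_resampling_space)
  interpret Q: prob_space Q by fact
  interpret I: prob_space "iid_indices r" using assms(3) by (rule prob_space_iid_indices)
  interpret J: prob_space "iid_indices q" using assms(4) by (rule prob_space_iid_indices)
  interpret IJ: pair_prob_space "iid_indices r" "iid_indices q" ..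
  define B where "B p = permute_matrix m n (fst p) (snd p) -` A \<inter> space Q" for p
  define S where "S p = B p \<times> (cylinder r m (fst p) \<times> cylinder q n (snd p))" for p
  have meas: "permute_matrix m n (fst p) (snd p) \<in> measurable Q (matrix_space m n)" if "p \<in> ?E" for p
    using permute_matrix_measurable_index_maps[OF Q, of "fst p" "snd p"] that by simp
  have maps: "fst p \<in> {..<m} \<rightarrow> {..<r}" "snd p \<in> {..<n} \<rightarrow> {..<q}" if "p \<in> ?E" for p
    using that by (simp_all add: index_maps_def mem_Times_iff PiE_def)
  have B: "B p \<in> sets Q" if "p \<in> ?E" for p
    unfolding B_def using meas[OF that] A by (rule measurable_sets)
  have S: "S p \<in> sets ?\<Omega>" if "p \<in> ?E" for p
    unfolding S_def resampling_space_def using B maps that by (intro pair_measureI sets_cylinder)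
  have measS: "measure ?\<Omega> (S p) = measure Q (B p) / (real r ^ m * real q ^ n)" if "p \<in> ?E" for p
  proof -
    have "emeasure ?\<Omega> (S p) = emeasure Q (B p) * (ennreal (1 / real r ^ m) * ennreal (1 / real q ^ n))"
      unfolding S_def resampling_space_def using B maps that assms(3,4)
      by (simp add: IJ.emeasure_pair_measure_Times J.emeasure_pair_measure_Times sets_cylinder
            emeasure_cylinder)
    then show ?thesis
      by (simp add: measure_def enn2real_mult)
  qed
  have sub: "submatrix m n (resampled_entries (Z, I, J)) = permute_matrix m n f g Z"
    if "I \<in> cylinder r m f" "J \<in> cylinder q n g" for Z I J f g
    using that by (auto simp: submatrix_def resampled_entries_def permute_matrix_def
        mem_cylinder_iff fun_eq_iff restrict_def)
  have "(submatrix m n \<circ> resampled_entries) -` A \<inter> space ?\<Omega> = (\<Union>p\<in>?E. S p)"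
  proof (intro equalityI subsetI)
    fix \<omega> assume w: "\<omega> \<in> (submatrix m n \<circ> resampled_entries) -` A \<inter> space ?\<Omega>"
    obtain Z I J where \<omega>: "\<omega> = (Z, I, J)" by (cases \<omega>)
    \<comment> \<open>The initial segments of both sequences, made extensional so that they form an
      element of \<open>index_maps\<close>.\<close>
    define p where "p = (restrict I {..<m}, restrict J {..<n})"
    have IJ: "Z \<in> space Q" "I \<in> space (iid_indices r)" "J \<in> space (iid_indices q)"
      using w unfolding \<omega> resampling_space_def by (auto simp: space_pair_measure)
    then have p: "p \<in> ?E" and cyl: "I \<in> cylinder r m (fst p)" "J \<in> cylinder q n (snd p)"
      by (auto simp: p_def index_maps_def mem_cylinder_iff space_iid_indices)
    have "permute_matrix m n (fst p) (snd p) Z \<in> A"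
      using w sub[OF cyl, of Z] unfolding \<omega> by simp
    then have "\<omega> \<in> S p" using cyl IJ unfolding \<omega> S_def B_def by simp
    then show "\<omega> \<in> (\<Union>p\<in>?E. S p)" using p by blast
  next
    fix \<omega> assume "\<omega> \<in> (\<Union>p\<in>?E. S p)"
    then obtain p where p: "p \<in> ?E" "\<omega> \<in> S p" by blast
    obtain Z I J where \<omega>: "\<omega> = (Z, I, J)" by (cases \<omega>)
    have "submatrix m n (resampled_entries \<omega>) = permute_matrix m n (fst p) (snd p) Z"
      using p(2) unfolding \<omega> S_def by (intro sub) auto
    moreover have "permute_matrix m n (fst p) (snd p) Z \<in> A"
      using p(2) unfolding \<omega> S_def B_def by simp
    moreover have "\<omega> \<in> space ?\<Omega>" using S[OF p(1)] p(2) sets.sets_into_space by blast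
    ultimately show "\<omega> \<in> (submatrix m n \<circ> resampled_entries) -` A \<inter> space ?\<Omega>" by simp
  qed
  moreover have "disjoint_family_on S ?E"
  proof (unfold disjoint_family_on_def, intro ballI impI)
    fix p p' assume pp: "p \<in> ?E" "p' \<in> ?E" "p \<noteq> p'"
    \<comment> \<open>At a common point both index maps are initial segments of the same two
      sequences, and extensionality makes them equal.\<close>
    have "p = p'" if "(Z, I, J) \<in> S p" "(Z, I, J) \<in> S p'" for Z I J
    proof (rule prod_eqI)
      show "fst p = fst p'"
      proof (rule PiE_ext[of _ "{..<m}" "\<lambda>_. {..<r}"])
        show "fst p \<in> {..<m} \<rightarrow>\<^sub>E {..<r}" "fst p' \<in> {..<m} \<rightarrow>\<^sub>E {..<r}"
          using pp by (simp_all add: index_maps_def mem_Times_iff)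
      qed (use that in \<open>simp add: S_def mem_cylinder_iff\<close>)
      show "snd p = snd p'"
      proof (rule PiE_ext[of _ "{..<n}" "\<lambda>_. {..<q}"])
        show "snd p \<in> {..<n} \<rightarrow>\<^sub>E {..<q}" "snd p' \<in> {..<n} \<rightarrow>\<^sub>E {..<q}"
          using pp by (simp_all add: index_maps_def mem_Times_iff)
      qed (use that in \<open>simp add: S_def mem_cylinder_iff\<close>)
    qed
    then show "S p \<inter> S p' = {}" using pp(3) by auto
  qed
  ultimately have "measure ?\<Omega> ((submatrix m n \<circ> resampled_entries) -` A \<inter> space ?\<Omega>)
      = (\<Sum>p\<in>?E. measure ?\<Omega> (S p))"
    using S by (simp add: Om.finite_measure_finite_Union image_subset_iff)
  also have "\<dots> = (\<Sum>p\<in>?E. measure Q (B p)) / (real r ^ m * real q ^ n)"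
    using measS by (simp add: sum_divide_distrib)
  also have "(\<Sum>p\<in>?E. measure Q (B p))
      = (\<Sum>p\<in>?E. measure (distr Q (matrix_space m n) (permute_matrix m n (fst p) (snd p))) A)"
    using meas A by (intro sum.cong refl) (simp add: measure_distr B_def)
  finally have "measure ?\<Omega> ((submatrix m n \<circ> resampled_entries) -` A \<inter> space ?\<Omega>)
      = resampled_prob m n r q Q A"
    unfolding resampled_prob_def case_prod_unfold .
  moreover have "projection m n (resampled_array r q Q)
      = distr ?\<Omega> (matrix_space m n) (submatrix m n \<circ> resampled_entries)"
    unfolding projection_def resampled_array_def
    using submatrix_measurable_array resampled_entries_measurable[OF Q] by (rule distr_distr)
  ultimately show ?thesis
    using A submatrix_measurable_array resampled_entries_measurable[OF Q]
    by (simp add: measure_distr)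
qed

text \<open>Precomposition with \<open>g\<close> and \<open>h\<close> permutes the set of index
  maps, so the average is merely reindexed.\<close>

lemma resampled_prob_permute:
  assumes Q: "sets Q = sets (matrix_space r q)" and A: "A \<in> sets (matrix_space m n)"
    and g: "g permutes {..<m}" and h: "h permutes {..<n}"
  shows "resampled_prob m n r q Q (permute_matrix m n g h -` A \<inter> space (matrix_space m n))
    = resampled_prob m n r q Q A"
proof -
  let ?M = "matrix_space m n" and ?E = "index_maps m n r q"
  let ?A' = "permute_matrix m n g h -` A \<inter> space ?M"
  let ?D = "\<lambda>p. distr Q ?M (permute_matrix m n (fst p) (snd p))"
  \<comment> \<open>The composition stays extensional because a permutation of \<open>{..<k}\<close>
    fixes every other index.\<close>
  have comp: "(f \<circ> p) \<in> {..<k} \<rightarrow>\<^sub>E {..<l}" if "f \<in> {..<k} \<rightarrow>\<^sub>E {..<l}" "p permutes {..<k}"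
    for f p and k l :: nat
  proof (rule PiE_I)
    show "(f \<circ> p) i \<in> {..<l}" if "i \<in> {..<k}" for i
    proof -
      have "p i \<in> {..<k}" using \<open>p permutes {..<k}\<close> that permutes_in_image by metis
      then show ?thesis using PiE_mem[OF \<open>f \<in> {..<k} \<rightarrow>\<^sub>E {..<l}\<close>] by simp
    qed
    show "(f \<circ> p) i = undefined" if "i \<notin> {..<k}" for i
      using PiE_arb[OF \<open>f \<in> {..<k} \<rightarrow>\<^sub>E {..<l}\<close> that] permutes_not_in[OF \<open>p permutes {..<k}\<close> that]
      by simp
  qed
  have gh: "g \<in> {..<m} \<rightarrow> {..<m}" "h \<in> {..<n} \<rightarrow> {..<n}"
    using permutes_in_image[OF g] permutes_in_image[OF h] by auto
  have "(\<Sum>p\<in>?E. measure (?D p) ?A') = (\<Sum>p\<in>?E. measure (?D p) A)"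
  proof (rule sum.reindex_bij_witness[where
        i = "\<lambda>p. (fst p \<circ> inv g, snd p \<circ> inv h)" and j = "\<lambda>p. (fst p \<circ> g, snd p \<circ> h)"])
    fix p assume p: "p \<in> ?E"
    show "(fst p \<circ> g, snd p \<circ> h) \<in> ?E" "(fst p \<circ> inv g, snd p \<circ> inv h) \<in> ?E"
      using p comp g h permutes_inv[OF g] permutes_inv[OF h]
      unfolding index_maps_def mem_Times_iff by simp_all
    show "(fst (fst p \<circ> g, snd p \<circ> h) \<circ> inv g, snd (fst p \<circ> g, snd p \<circ> h) \<circ> inv h) = p"
      "(fst (fst p \<circ> inv g, snd p \<circ> inv h) \<circ> g, snd (fst p \<circ> inv g, snd p \<circ> inv h) \<circ> h) = p"
      using permutes_inv_o[OF g] permutes_inv_o[OF h] by (simp_all add: comp_assoc)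
    have meas: "permute_matrix m n (fst p) (snd p) \<in> measurable Q ?M"
      using permute_matrix_measurable_index_maps[OF Q, of "fst p" "snd p"] p by simp
    have "measure (?D p) ?A' = measure (distr (?D p) ?M (permute_matrix m n g h)) A"
      using permute_matrix_measurable[OF g h] A by (simp add: measure_distr)
    also have "distr (?D p) ?M (permute_matrix m n g h)
        = distr Q ?M (permute_matrix m n g h \<circ> permute_matrix m n (fst p) (snd p))"
      using permute_matrix_measurable[OF g h] meas by (rule distr_distr)
    also have "permute_matrix m n g h \<circ> permute_matrix m n (fst p) (snd p)
        = permute_matrix m n (fst p \<circ> g) (snd p \<circ> h)"
      using permute_matrix_comp[OF gh] by (simp add: fun_eq_iff)
    finally show "measure (?D (fst p \<circ> g, snd p \<circ> h)) A = measure (?D p) ?A'"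
      by simp
  qed
  then show ?thesis unfolding resampled_prob_def case_prod_unfold by simp
qed

text \<open>Every finite corner has its law given by \<open>resampled_prob\<close>, which is
  invariant under permutations. Drawing with replacement allows corners of any size, also beyond
  \<open>r\<close> and \<open>q\<close>.\<close>

lemma inf_rc_exchangeable_resampled_array:
  assumes "prob_space Q" and Q: "sets Q = sets (matrix_space r q)" and "0 < r" "0 < q"
  shows "inf_rc_exchangeable (resampled_array r q Q)"
proof -
  let ?X = "resampled_array r q Q"
  have prob: "prob_space ?X"
    unfolding resampled_array_def
    using assms resampled_entries_measurable
    by (intro prob_space.prob_space_distr prob_space_resampling_space)
  have sets: "sets ?X = sets array_space" by (simp add: resampled_array_def)
  have "rc_exchangeable m n (projection m n ?X)" for m n
  proof -
    let ?M = "matrix_space m n" and ?P = "projection m n ?X"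
    have "submatrix m n \<in> measurable ?X ?M"
      using submatrix_measurable_array measurable_cong_sets[OF sets refl] by blast
    then have P: "prob_space ?P"
      unfolding projection_def using prob by (intro prob_space.prob_space_distr)
    have setsP: "sets ?P = sets ?M" by (simp add: projection_def)
    have "distr ?P ?M (permute_matrix m n g h) = ?P"
      if g: "g permutes {..<m}" and h: "h permutes {..<n}" for g h
    proof (rule measure_eqI)
      fix A assume "A \<in> sets (distr ?P ?M (permute_matrix m n g h))"
      then have A: "A \<in> sets ?M" by simp
      have meas: "permute_matrix m n g h \<in> measurable ?P ?M"
        using permute_matrix_measurable[OF g h] measurable_cong_sets[OF setsP refl] by blast
      have sp: "space ?P = space ?M" using setsP by (rule sets_eq_imp_space_eq)
      have "measure (distr ?P ?M (permute_matrix m n g h)) A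
          = measure ?P (permute_matrix m n g h -` A \<inter> space ?M)"
        using meas A by (simp add: measure_distr sp)
      also have "\<dots> = resampled_prob m n r q Q (permute_matrix m n g h -` A \<inter> space ?M)"
        using assms measurable_sets[OF permute_matrix_measurable[OF g h] A]
        by (rule measure_projection_resampled_array)
      also have "\<dots> = measure ?P A"
        using resampled_prob_permute[OF Q A g h] measure_projection_resampled_array[OF assms A] by simp
      finally have "measure (distr ?P ?M (permute_matrix m n g h)) A = measure ?P A" .
      moreover have "prob_space (distr ?P ?M (permute_matrix m n g h))"
        using P meas by (rule prob_space.prob_space_distr)
      ultimately show "emeasure (distr ?P ?M (permute_matrix m n g h)) A = emeasure ?P A"
        using P by (simp add: finite_measure.emeasure_eq_measure prob_space_def)
    qed (simp add: setsP)
    then show ?thesis using P setsP unfolding rc_exchangeable_def by blast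
  qed
  then show ?thesis using prob sets unfolding inf_rc_exchangeable_def by blast
qed

lemma tv_dist_resampled_array:
  assumes Q: "rc_exchangeable r q Q" and "m \<le> r" "n \<le> q" "0 < r" "0 < q"
  shows "tv_dist (projection m n Q) (projection m n (resampled_array r q Q)) \<le> beta_bound m n r q"
  unfolding tv_dist_def
proof (rule cSUP_least)
  fix A assume "A \<in> sets (projection m n Q)"
  then have "A \<in> sets (matrix_space m n)" by (simp add: projection_def)
  from measure_projection_resampled_array[OF rc_exchangeableD(1,2)[OF Q] assms(4,5) this]
  show "\<bar>measure (projection m n Q) A - measure (projection m n (resampled_array r q Q)) A\<bar>
      \<le> beta_bound m n r q"
    using resampled_prob_close[OF assms, of A] by simp
qed auto

subsection \<open>The extremal law\<close>

text \<open>A value lies below the supremum only if the supremum is over a bounded set; for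
  probability measures all differences are at most 1.\<close>

lemma tv_dist_ge:
  assumes "prob_space P" "prob_space Q" "A \<in> sets P"
  shows "\<bar>measure P A - measure Q A\<bar> \<le> tv_dist P Q"
  unfolding tv_dist_def
proof (rule cSUP_upper[OF assms(3)])
  show "bdd_above ((\<lambda>A. \<bar>measure P A - measure Q A\<bar>) ` sets P)"
  proof (rule bdd_aboveI2)
    fix A
    show "\<bar>measure P A - measure Q A\<bar> \<le> 1"
      using prob_space.prob_le_1[OF assms(1), of A] prob_space.prob_le_1[OF assms(2), of A]
        measure_nonneg[of P A] measure_nonneg[of Q A] by linarith
  qed
qed

section \<open>Projections of exchangeable laws\<close>

lemma projection_projection_array:
  assumes "sets Q = sets array_space" "k \<le> m" "l \<le> n"
  shows "projection k l (projection m n Q) = projection k l Q"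
proof -
  have "submatrix m n \<in> measurable Q (matrix_space m n)"
    using submatrix_measurable_array measurable_cong_sets[OF assms(1) refl] by blast
  moreover have "submatrix k l \<circ> submatrix m n = submatrix k l"
    using assms(2,3) by (auto simp: submatrix_def fun_eq_iff restrict_def)
  ultimately show ?thesis
    unfolding projection_def using submatrix_measurable[OF assms(2,3)] by (simp add: distr_distr)
qed

text \<open>A permutation of the smaller index set also permutes the larger one, fixing the added
  indices, and thus commutes with taking the leading corner.\<close>

lemma rc_exchangeable_projection:
  assumes Q: "rc_exchangeable r q Q" and "m \<le> r" "n \<le> q"
  shows "rc_exchangeable m n (projection m n Q)"
  unfolding rc_exchangeable_def
proof (intro conjI allI impI)
  let ?M = "matrix_space m n" and ?R = "matrix_space r q"
  show "prob_space (projection m n Q)" using assms by (rule prob_space_projection)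
  show "sets (projection m n Q) = sets ?M" by (simp add: projection_def)
  fix g h assume g: "g permutes {..<m}" and h: "h permutes {..<n}"
  have sub: "submatrix m n \<in> measurable Q ?M"
    using submatrix_measurable[OF assms(2,3)] measurable_cong_sets[OF rc_exchangeableD(2)[OF Q] refl]
    by blast
  have gh: "g permutes {..<r}" "h permutes {..<q}"
    using g h assms(2,3) by (auto intro: permutes_subset)
  have meas: "permute_matrix r q g h \<in> measurable Q ?R"
    using permute_matrix_measurable[OF gh] measurable_cong_sets[OF rc_exchangeableD(2)[OF Q] refl]
    by blast
  have in_mn: "g \<in> {..<m} \<rightarrow> {..<m}" "h \<in> {..<n} \<rightarrow> {..<n}"
    using permutes_in_image[OF g] permutes_in_image[OF h] by auto
  have "distr (projection m n Q) ?M (permute_matrix m n g h)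
      = distr Q ?M (permute_matrix m n g h \<circ> submatrix m n)"
    unfolding projection_def using permute_matrix_measurable[OF g h] sub by (rule distr_distr)
  also have "permute_matrix m n g h \<circ> submatrix m n = submatrix m n \<circ> permute_matrix r q g h"
    using assms(2,3) in_mn
    by (auto simp: submatrix_eq_permute_matrix fun_eq_iff permute_matrix_comp
        permute_matrix_comp[where m = m and n = n and r = r and q = q and f = id and g = id])
  also have "distr Q ?M \<dots> = distr (distr Q ?R (permute_matrix r q g h)) ?M (submatrix m n)"
    using submatrix_measurable[OF assms(2,3)] meas by (rule distr_distr[symmetric])
  also have "\<dots> = projection m n Q"
    using rc_exchangeableD(3)[OF Q gh] by (simp add: projection_def)
  finally show "distr (projection m n Q) ?M (permute_matrix m n g h) = projection m n Q" .
qed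

text \<open>Coding the position as one real number lets each entry of a permuted matrix reveal the
  row and the column from which it came.\<close>

definition label_array :: "nat \<times> nat \<Rightarrow> real" where
  "label_array p = real (prod_encode p)"

definition shuffled_labels :: "nat \<Rightarrow> nat \<Rightarrow> (nat \<times> nat \<Rightarrow> real) measure" where
  "shuffled_labels r q =
     distr (measure_pmf (pmf_of_set ({g. g permutes {..<r}} \<times> {h. h permutes {..<q}})))
       (matrix_space r q) (\<lambda>(g, h). permute_matrix r q g h label_array)"

lemma permute_matrix_in_space: "permute_matrix m n g h X \<in> space (matrix_space m n)"
  by (auto simp: permute_matrix_def matrix_space_def space_PiM)

text \<open>A uniform permutation composed with a fixed one is again uniform.\<close>

lemma rc_exchangeable_shuffled_labels: "rc_exchangeable r q (shuffled_labels r q)"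
proof -
  let ?A = "{g. g permutes {..<r}} \<times> {h. h permutes {..<q}}" and ?M = "matrix_space r q"
  let ?\<mu> = "pmf_of_set ?A"
  let ?F = "\<lambda>p. permute_matrix r q (fst p) (snd p) label_array"
  have F: "?F \<in> measurable (measure_pmf ?\<mu>) ?M"
    by (simp add: permute_matrix_in_space)
  have def: "shuffled_labels r q = distr (measure_pmf ?\<mu>) ?M ?F"
    by (simp add: shuffled_labels_def case_prod_unfold)
  have fin: "finite ?A" by (simp add: finite_permutations)
  have ne: "?A \<noteq> {}" using permutes_id by blast
  have "distr (shuffled_labels r q) ?M (permute_matrix r q g h) = shuffled_labels r q"
    if g: "g permutes {..<r}" and h: "h permutes {..<q}" for g h
  proof -
    let ?T = "\<lambda>p. (fst p \<circ> g, snd p \<circ> h)"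
    have "bij_betw ?T ?A ?A"
      using permutes_inv_o[OF g] permutes_inv_o[OF h] permutes_inv[OF g] permutes_inv[OF h] g h
      by (intro bij_betw_byWitness[where f' = "\<lambda>p. (fst p \<circ> inv g, snd p \<circ> inv h)"])
        (auto simp: comp_assoc intro: permutes_compose)
    then have T: "map_pmf ?T ?\<mu> = ?\<mu>"
      using ne fin by (rule map_pmf_of_set_bij_betw)
    have gh: "g \<in> {..<r} \<rightarrow> {..<r}" "h \<in> {..<q} \<rightarrow> {..<q}"
      using permutes_in_image[OF g] permutes_in_image[OF h] by auto
    have "distr (shuffled_labels r q) ?M (permute_matrix r q g h)
        = distr (measure_pmf ?\<mu>) ?M (permute_matrix r q g h \<circ> ?F)"
      unfolding def using permute_matrix_measurable[OF g h] F by (rule distr_distr)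
    also have "permute_matrix r q g h \<circ> ?F = ?F \<circ> ?T"
      by (simp add: fun_eq_iff permute_matrix_comp[OF gh])
    also have "distr (measure_pmf ?\<mu>) ?M (?F \<circ> ?T)
        = distr (distr (measure_pmf ?\<mu>) (count_space UNIV) ?T) ?M ?F"
      by (rule distr_distr[symmetric]) (simp_all add: permute_matrix_in_space)
    also have "\<dots> = distr (measure_pmf (map_pmf ?T ?\<mu>)) ?M ?F"
      by (simp add: map_pmf_rep_eq)
    finally show ?thesis unfolding T def .
  qed
  moreover have "prob_space (shuffled_labels r q)"
    unfolding def using F by (intro prob_space.prob_space_distr) (rule prob_space_measure_pmf)
  moreover have "sets (shuffled_labels r q) = sets ?M" by (simp add: def)
  ultimately show ?thesis unfolding rc_exchangeable_def by blast
qed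

section \<open>The event that witnesses tightness\<close>

definition injective_submatrices :: "nat \<Rightarrow> nat \<Rightarrow> nat \<Rightarrow> nat \<Rightarrow> (nat \<times> nat \<Rightarrow> real) set" where
  "injective_submatrices m n r q =
     (\<lambda>(f, g). permute_matrix m n f g label_array) ` (injections m r \<times> injections n q)"

lemma sets_injective_submatrices: "injective_submatrices m n r q \<in> sets (matrix_space m n)"
proof -
  have "{X} \<in> sets (matrix_space m n)" if "X \<in> space (matrix_space m n)" for X
  proof -
    have X: "X \<in> ({..<m} \<times> {..<n}) \<rightarrow>\<^sub>E UNIV"
      using that by (simp add: matrix_space_def space_PiM)
    have "(\<Pi>\<^sub>E p\<in>{..<m} \<times> {..<n}. {X p}) = {X}"
      using X by (intro PiE_singleton) (simp add: PiE_def)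
    moreover have "(\<Pi>\<^sub>E p\<in>{..<m} \<times> {..<n}. {X p}) \<in> sets (matrix_space m n)"
      unfolding matrix_space_def by (rule sets_PiM_I_finite) auto
    ultimately show ?thesis by simp
  qed
  then have "(\<Union>X\<in>injective_submatrices m n r q. {X}) \<in> sets (matrix_space m n)"
    unfolding injective_submatrices_def
    by (intro sets.finite_UN) (auto simp: permute_matrix_in_space)
  then show ?thesis by simp
qed

text \<open>Permutations restricted to initial segments are injections, so every outcome lies in the
  event.\<close>

lemma measure_shuffled_labels:
  assumes "m \<le> r" "n \<le> q"
  shows "measure (projection m n (shuffled_labels r q)) (injective_submatrices m n r q) = 1"
proof -
  let ?A = "{g. g permutes {..<r}} \<times> {h. h permutes {..<q}}"
  let ?\<mu> = "pmf_of_set ?A"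
  let ?F = "\<lambda>p. permute_matrix r q (fst p) (snd p) label_array"
  let ?S = "injective_submatrices m n r q"
  have fin: "finite ?A" by (simp add: finite_permutations)
  have ne: "?A \<noteq> {}" using permutes_id by blast
  have F: "?F \<in> measurable (measure_pmf ?\<mu>) (matrix_space r q)"
    by (simp add: permute_matrix_in_space)
  have inj: "restrict g {..<k} \<in> injections k l" if "g permutes {..<l}" "k \<le> l" for g and k l :: nat
  proof -
    have "g i < l" if "i < k" for i
      using permutes_in_image[OF \<open>g permutes {..<l}\<close>, of i] that \<open>k \<le> l\<close> by simp
    moreover have "inj_on g {..<k}"
      using permutes_inj[OF that(1)] by (rule inj_on_subset) simp
    ultimately show ?thesis unfolding injections_def by simp
  qed
  have mem: "submatrix m n (?F p) \<in> ?S" if "p \<in> ?A" for p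
  proof -
    have "submatrix m n (?F p) = permute_matrix m n (fst p) (snd p) label_array"
      using assms unfolding submatrix_eq_permute_matrix by (subst permute_matrix_comp) auto
    also have "\<dots> = permute_matrix m n (restrict (fst p) {..<m}) (restrict (snd p) {..<n}) label_array"
      by (subst permute_matrix_cong) auto
    finally show ?thesis
      using that inj assms unfolding injective_submatrices_def
      by (intro image_eqI[where x = "(restrict (fst p) {..<m}, restrict (snd p) {..<n})"])
        (auto simp: mem_Times_iff)
  qed
  have "projection m n (shuffled_labels r q)
      = distr (measure_pmf ?\<mu>) (matrix_space m n) (submatrix m n \<circ> ?F)"
    unfolding projection_def shuffled_labels_def case_prod_unfold
    using submatrix_measurable[OF assms] F by (rule distr_distr)
  moreover have "submatrix m n \<circ> ?F \<in> measurable (measure_pmf ?\<mu>) (matrix_space m n)"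
    using submatrix_measurable[OF assms] F by (rule measurable_comp[rotated])
  ultimately have "measure (projection m n (shuffled_labels r q)) ?S
      = measure (measure_pmf ?\<mu>) ((submatrix m n \<circ> ?F) -` ?S)"
    using sets_injective_submatrices by (simp add: measure_distr)
  also have "\<dots> = 1"
    using mem fin ne by (subst measure_pmf.prob_eq_1) (auto simp: AE_measure_pmf_iff)
  finally show ?thesis .
qed

text \<open>For a fixed matrix, decoding its entries labels each cell with a row and a column, and
  \<open>card_labelled_grid_le\<close> bounds the number of index maps that hit the event.
  Integrating this count over \<open>Q\<close> bounds the sum of the probabilities.\<close>

lemma resampled_prob_injective_submatrices:
  assumes Q: "rc_exchangeable N N Q" and "1 \<le> m" "m \<le> r" "1 \<le> n" "n \<le> q" "0 < N"
  shows "resampled_prob m n N N Q (injective_submatrices m n r q)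
    \<le> inj_fraction m r * inj_fraction n q"
proof -
  let ?E = "index_maps m n N N" and ?M = "matrix_space m n"
  let ?S = "injective_submatrices m n r q"
  interpret Q: prob_space Q using Q by (rule rc_exchangeableD)
  define B where "B p = permute_matrix m n (fst p) (snd p) -` ?S \<inter> space Q" for p
  define K where "K = inj_fraction m r * inj_fraction n q * (real N ^ m * real N ^ n)"
  have meas: "permute_matrix m n (fst p) (snd p) \<in> measurable Q ?M" if "p \<in> ?E" for p
    using permute_matrix_measurable_index_maps[OF rc_exchangeableD(2)[OF Q], of "fst p" "snd p"] that
    by simp
  have B: "B p \<in> sets Q" if "p \<in> ?E" for p
    unfolding B_def using meas[OF that] sets_injective_submatrices by (rule measurable_sets)
  have integrable: "integrable Q (indicator (B p) :: _ \<Rightarrow> real)" if "p \<in> ?E" for p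
    using B[OF that] by (rule integrable_real_indicator) (simp add: Q.emeasure_eq_measure)
  have count: "(\<Sum>p\<in>?E. indicator (B p) Z) \<le> K" for Z
  proof -
    \<comment> \<open>Rounding down and decoding recovers the pair from a code. Entries that are not
      codes receive meaningless labels, which can only enlarge the set being counted.\<close>
    define R where "R i k = fst (prod_decode (nat \<lfloor>Z (i, k)\<rfloor>))" for i k
    define C where "C i k = snd (prod_decode (nat \<lfloor>Z (i, k)\<rfloor>))" for i k
    let ?G = "{(f, g). f \<in> {..<m} \<rightarrow>\<^sub>E {..<N} \<and> g \<in> {..<n} \<rightarrow>\<^sub>E {..<N} \<and>
      (\<exists>\<rho>\<in>injections m r. \<exists>\<gamma>\<in>injections n q.
         \<forall>i<m. \<forall>j<n. R (f i) (g j) = \<rho> i \<and> C (f i) (g j) = \<gamma> j)}"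
    have "?G \<subseteq> ?E" unfolding index_maps_def by blast
    then have finG: "finite ?G" by (rule finite_subset) simp
    have "{p \<in> ?E. Z \<in> B p} \<subseteq> ?G"
    proof
      fix p assume p: "p \<in> {p \<in> ?E. Z \<in> B p}"
      obtain f g where fg: "p = (f, g)" by (cases p)
      obtain \<rho> \<gamma> where rg: "\<rho> \<in> injections m r" "\<gamma> \<in> injections n q"
        and eq: "permute_matrix m n f g Z = permute_matrix m n \<rho> \<gamma> label_array"
        using p unfolding fg B_def injective_submatrices_def by auto
      have "Z (f i, g j) = real (prod_encode (\<rho> i, \<gamma> j))" if "i < m" "j < n" for i j
        using fun_cong[OF eq, of "(i, j)"] that by (simp add: permute_matrix_def label_array_def)
      then have "R (f i) (g j) = \<rho> i \<and> C (f i) (g j) = \<gamma> j" if "i < m" "j < n" for i j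
        using that unfolding R_def C_def by simp
      then show "p \<in> ?G"
        using p rg unfolding fg index_maps_def by blast
    qed
    then have "card {p \<in> ?E. Z \<in> B p} \<le> card ?G"
      using finG by (rule card_mono[rotated])
    moreover have "real (card ?G) \<le> K"
      unfolding K_def using assms(2-5) by (rule card_labelled_grid_le)
    moreover have "(\<Sum>p\<in>?E. indicator (B p) Z) = real (card {p \<in> ?E. Z \<in> B p})"
      by (simp add: indicator_def sum.If_cases Int_def)
    ultimately show ?thesis by linarith
  qed
  have "(\<Sum>p\<in>?E. measure (distr Q ?M (permute_matrix m n (fst p) (snd p))) ?S)
      = (\<Sum>p\<in>?E. measure Q (B p))"
    using meas sets_injective_submatrices by (intro sum.cong refl) (simp add: measure_distr B_def)
  also have "\<dots> = (\<Sum>p\<in>?E. \<integral>Z. indicator (B p) Z \<partial>Q)"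
    using B by (intro sum.cong refl) (simp add: Int_absorb2 sets.sets_into_space)
  also have "\<dots> = (\<integral>Z. (\<Sum>p\<in>?E. indicator (B p) Z) \<partial>Q)"
    using integrable by (intro Bochner_Integration.integral_sum[symmetric])
  also have "\<dots> \<le> (\<integral>Z. K \<partial>Q)"
    using integrable count by (intro integral_mono Bochner_Integration.integrable_sum) auto
  also have "\<dots> = K" by (simp add: Q.prob_space)
  finally show ?thesis
    using assms(6) unfolding resampled_prob_def K_def by (simp add: case_prod_unfold field_simps)
qed

section \<open>Passage to large corners of an infinite array\<close>

lemma beta_bound_diagonal_tendsto: "(\<lambda>N. beta_bound m n N N) \<longlonglongrightarrow> 0"
proof -
  have "(\<lambda>N. 1 - inj_fraction m N * inj_fraction n N) \<longlonglongrightarrow> 1 - 1 * 1"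
    by (intro tendsto_intros inj_fraction_tendsto)
  moreover have "\<forall>\<^sub>F N in sequentially. beta_bound m n N N = 1 - inj_fraction m N * inj_fraction n N"
    using eventually_ge_at_top[of "max m n"] by eventually_elim (simp add: beta_bound_eq)
  ultimately show ?thesis by (simp add: tendsto_cong)
qed

text \<open>For each large \<open>N\<close> the \<open>N \<times> N\<close> corner is exchangeable,
  and resampling it changes the probability by at most \<open>beta_bound m n N N\<close>. The
  probability itself does not depend on \<open>N\<close>, so this error disappears in the
  limit.\<close>

lemma inf_rc_exchangeable_injective_submatrices:
  assumes Q: "inf_rc_exchangeable Q" and "1 \<le> m" "m \<le> r" "1 \<le> n" "n \<le> q"
  shows "measure (projection m n Q) (injective_submatrices m n r q) \<le> 1 - beta_bound m n r q"
proof -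
  let ?S = "injective_submatrices m n r q"
  have bound: "measure (projection m n Q) ?S
      \<le> inj_fraction m r * inj_fraction n q + beta_bound m n N N"
    if N: "N \<ge> max m n" for N
  proof -
    have QN: "rc_exchangeable N N (projection N N Q)"
      using Q N assms(2) unfolding inf_rc_exchangeable_def by auto
    have "projection m n (projection N N Q) = projection m n Q"
      using Q N by (intro projection_projection_array) (auto simp: inf_rc_exchangeable_def)
    then show ?thesis
      using resampled_prob_close[OF QN, of m n ?S] N assms(2)
        resampled_prob_injective_submatrices[OF QN assms(2-5)]
      by (auto simp: abs_le_iff)
  qed
  have "(\<lambda>N. inj_fraction m r * inj_fraction n q + beta_bound m n N N)
      \<longlonglongrightarrow> inj_fraction m r * inj_fraction n q + 0"
    by (intro tendsto_intros beta_bound_diagonal_tendsto)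
  then have "measure (projection m n Q) ?S \<le> inj_fraction m r * inj_fraction n q + 0"
    using bound by (intro LIMSEQ_le_const) blast+
  then show ?thesis using assms by (simp add: beta_bound_eq)
qed

theorem theorem4:
  fixes m n r q :: nat
  assumes "1 \<le> m" and "m \<le> r" and "1 \<le> n" and "n \<le> q"
  shows "(\<forall>P. rc_exchangeable m n P \<and> rc_extendible m n r q P \<longrightarrow>
            (\<exists>Q. inf_rc_exchangeable Q \<and>
                 tv_dist P (projection m n Q) \<le> beta_bound m n r q)) \<and>
         (\<exists>P. rc_exchangeable m n P \<and> rc_extendible m n r q P \<and>
            (\<forall>Q. inf_rc_exchangeable Q \<longrightarrow>
                 tv_dist P (projection m n Q) \<ge> beta_bound m n r q))"
proof (intro conjI allI impI)
  fix P assume "rc_exchangeable m n P \<and> rc_extendible m n r q P"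
  then obtain Q where Q: "rc_exchangeable r q Q" "projection m n Q = P"
    unfolding rc_extendible_def by blast
  have "inf_rc_exchangeable (resampled_array r q Q)"
    using rc_exchangeableD(1,2)[OF Q(1)] assms by (intro inf_rc_exchangeable_resampled_array) auto
  moreover have "tv_dist P (projection m n (resampled_array r q Q)) \<le> beta_bound m n r q"
    using tv_dist_resampled_array[OF Q(1), of m n] assms Q(2) by auto
  ultimately show "\<exists>Q. inf_rc_exchangeable Q \<and> tv_dist P (projection m n Q) \<le> beta_bound m n r q"
    by blast
next
  \<comment> \<open>The event \<open>?S\<close> has probability 1 under \<open>?P\<close> and at
    most \<open>1 - beta_bound m n r q\<close> under the competing projections, so it alone forces
    the distance.\<close>
  let ?P = "projection m n (shuffled_labels r q)" and ?S = "injective_submatrices m n r q"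
  have P: "rc_exchangeable m n ?P"
    using rc_exchangeable_shuffled_labels assms(2,4) by (rule rc_exchangeable_projection)
  moreover have "rc_extendible m n r q ?P"
    using rc_exchangeable_shuffled_labels assms(2,4) unfolding rc_extendible_def by blast
  moreover have "beta_bound m n r q \<le> tv_dist ?P (projection m n Q)"
    if Q: "inf_rc_exchangeable Q" for Q
  proof -
    have "rc_exchangeable m n (projection m n Q)"
      using Q assms unfolding inf_rc_exchangeable_def by blast
    then have "\<bar>measure ?P ?S - measure (projection m n Q) ?S\<bar> \<le> tv_dist ?P (projection m n Q)"
      using rc_exchangeableD(1) rc_exchangeableD(2)[OF P] P sets_injective_submatrices
      by (intro tv_dist_ge) auto
    then show ?thesis
      using inf_rc_exchangeable_injective_submatrices[OF Q assms]
        measure_shuffled_labels[OF assms(2,4)] by linarith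
  qed
  ultimately show "\<exists>P. rc_exchangeable m n P \<and> rc_extendible m n r q P \<and>
      (\<forall>Q. inf_rc_exchangeable Q \<longrightarrow> tv_dist P (projection m n Q) \<ge> beta_bound m n r q)"
    by blast
qed

end
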